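(* Let $L \subseteq \mathcal{S}^n$ be a linear subspace. Then $\mathrm{GCR}(L)$ is the minimum $d$ such that for all generic PSD $S$ of rank $d$, there does not exist a nonzero $\Omega \in L$ such that $\Omega S = 0$. Moreover, if $L$ contains a positive definite matrix, then $\mathrm{GCR}(L) \ge \mathrm{MLT}(L)$.
   Context: $\mathcal{S}^n$ is the vector space of real symmetric $n\times n$ matrices ($n\ge 1$) with inner product $\mathrm{Tr}(AB)$; $\mathcal{S}^n_+$ is the cone of positive semidefinite (PSD) matrices, $\mathcal{S}^n_{++}$ the cone of positive definite matrices, and $\mathcal{S}^n_0(d)$ the set of matrices in $\mathcal{S}^n$ of rank exactly $d$. $\pi_L:\mathcal{S}^n\to L$ is orthogonal projection. The generic completion rank $\mathrm{GCR}(L)$ is the minimum $d$ such that $\pi_L(\mathcal{S}^n_0(d))$ is full-dimensional in $L$ (has dimension $\dim L$). A statement holds "for all generic PSD $S$ of rank $d$" if it holds for all $S$ in some nonempty Zariski-open subset of the set of PSD matrices of rank exactly $d$ (Zariski topology induced from $\mathcal{S}^n$). For $L$ containing a positive definite matrix, the maximum likelihood threshold $\mathrm{MLT}(L)$ is the minimum $d$ such that, for all generic PSD $S$ of rank $d$, the problem of minimizing $\mathrm{Tr}(SK)-\log\det K$ over $K\in L\cap\mathcal{S}^n_{++}$ has a solution (the minimum is attained). *)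

theory Defs
  imports "HOL-Analysis.Analysis"
begin

definition sym_mats :: "(real^'n^'n) set" where
  "sym_mats = {A. transpose A = A}"

definition sym_rank :: "nat \<Rightarrow> (real^'n^'n) set" where
  "sym_rank d = {A \<in> sym_mats. rank A = d}"

definition psd :: "real^'n^'n \<Rightarrow> bool" where
  "psd A \<longleftrightarrow> A \<in> sym_mats \<and> (\<forall>x. x \<bullet> (A *v x) \<ge> 0)"

definition pos_def :: "real^'n^'n \<Rightarrow> bool" where
  "pos_def A \<longleftrightarrow> A \<in> sym_mats \<and> (\<forall>x. x \<noteq> 0 \<longrightarrow> x \<bullet> (A *v x) > 0)"

definition psd_rank :: "nat \<Rightarrow> (real^'n^'n) set" where
  "psd_rank d = {A. psd A \<and> rank A = d}"

text \<open>The orthogonal projection of a symmetric matrix onto a subspace \<open>L\<close> of symmetric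
  matrices, for the inner product \<open>Tr (A B)\<close>. It is uniquely determined in that case;
  the trace form is not definite on all square matrices.\<close>

definition orth_proj :: "(real^'n^'n) set \<Rightarrow> real^'n^'n \<Rightarrow> real^'n^'n" where
  "orth_proj L A = (THE P. P \<in> L \<and> (\<forall>B\<in>L. trace ((A - P) ** B) = 0))"

text \<open>Dimension of a semialgebraic set: the largest dimension of an open cell contained in it
  (not the dimension of its linear or affine span), with \<open>-1\<close> for the empty set. The cells are
  the subsets homeomorphic to the open unit ball of a \<open>k\<close>-dimensional Euclidean space, here a
  \<open>k\<close>-dimensional subspace \<open>T\<close>; as \<open>k = dim T \<le> DIM('a)\<close>, the maximum exists whenever
  \<open>X\<close> is nonempty.\<close>

definition semialg_dim :: "'a::euclidean_space set \<Rightarrow> int" where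
  "semialg_dim X =
     (if X = {} then -1
      else int (Max {k. \<exists>(T :: 'a set) U. subspace T \<and> dim T = k \<and> U \<subseteq> X \<and> U homeomorphic (ball 0 1 \<inter> T)}))"

definition GCR :: "(real^'n^'n) set \<Rightarrow> nat" where
  "GCR L = (LEAST d. semialg_dim (orth_proj L ` sym_rank d) = int (dim L))"

text \<open>Subsets of \<open>X\<close> that are open in the Zariski topology induced on \<open>X\<close>: complements in \<open>X\<close> of
  the common zero set of a family of polynomials. Every polynomial function on the symmetric
  matrices is the restriction of one on all square matrices.\<close>

definition zariski_open_in :: "'a::euclidean_space set \<Rightarrow> 'a set \<Rightarrow> bool" where
  "zariski_open_in X U \<longleftrightarrow>
     (\<exists>P. (\<forall>p\<in>P. real_polynomial_function p) \<and> U = X - {x. \<forall>p\<in>P. p x = 0})"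

definition generic_psd :: "nat \<Rightarrow> (real^'n^'n \<Rightarrow> bool) \<Rightarrow> bool" where
  "generic_psd d Q \<longleftrightarrow> (\<exists>U. zariski_open_in (psd_rank d) U \<and> U \<noteq> {} \<and> (\<forall>S\<in>U. Q S))"

definition neg_log_lik :: "real^'n^'n \<Rightarrow> real^'n^'n \<Rightarrow> real" where
  "neg_log_lik S K = trace (S ** K) - ln (det K)"

definition MLE_exists :: "(real^'n^'n) set \<Rightarrow> real^'n^'n \<Rightarrow> bool" where
  "MLE_exists L S \<longleftrightarrow>
     (\<exists>K \<in> L \<inter> Collect pos_def. \<forall>K' \<in> L \<inter> Collect pos_def. neg_log_lik S K \<le> neg_log_lik S K')"

text \<open>Meaningful only if \<open>L\<close> contains a positive definite matrix.\<close>

definition MLT :: "(real^'n^'n) set \<Rightarrow> nat" where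
  "MLT L = (LEAST d. generic_psd d (MLE_exists L))"

end

theory Submission
  imports Defs
begin

text \<open>Everything reduces to one condition on \<open>d\<close> from linear algebra: some \<open>d\<close>-dimensional subspace
  \<open>R\<close> of \<open>\<real>\<^sup>n\<close> is such that no nonzero \<open>\<Omega>\<close> in \<open>L\<close> vanishes on \<open>R\<close> (\<open>no_annihilator L R\<close>).

  For a matrix \<open>S\<close> with range \<open>R\<close>, the equation \<open>\<Omega> S = 0\<close> says that \<open>\<Omega>\<close> vanishes on \<open>R\<close>, and every
  subspace is the range of a positive semidefinite matrix. So the condition says that a single
  positive semidefinite \<open>S\<close> of rank \<open>d\<close> has no nonzero annihilator in \<open>L\<close>. One such \<open>S\<close> is as good as
  a generic one, because injectivity of \<open>\<Omega> \<mapsto> \<Omega> S\<close> on \<open>L\<close> is the nonvanishing of a determinant that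
  is polynomial in \<open>S\<close> (lemma \<open>generic_psd_iff_subspace\<close>).

  On the other side, the symmetric matrices \<open>\<Omega>\<close> with \<open>\<Omega> S = 0\<close> form the normal space at \<open>S\<close> of the
  manifold of symmetric matrices of rank \<open>d\<close>. Hence the projection of that manifold to \<open>L\<close> is a
  submersion at \<open>S\<close> exactly when the range of \<open>S\<close> has no nonzero annihilator in \<open>L\<close>. A submersion at
  one point gives an image with interior (\<open>subspace_imp_projection_interior\<close>). For the converse
  (\<open>projection_interior_imp_subspace\<close>) one needs a form of Sard's theorem: a polynomial map whose image has
  interior has a surjective derivative somewhere. It is proved algebraically, as the Jacobian
  criterion for algebraic independence in characteristic zero
  (\<open>polynomial_image_interior_imp_surj_derivative\<close>). By invariance of domain, a subset of \<open>L\<close> has dimension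
  \<open>dim L\<close> exactly when it has nonempty interior in \<open>L\<close> (\<open>semialg_dim_eq_dim_iff\<close>).

  For the threshold, if \<open>S\<close> is positive semidefinite without annihilators in \<open>L\<close>, then \<open>Tr (S K)\<close> is
  positive for every nonzero positive semidefinite \<open>K\<close> in \<open>L\<close>. By compactness it grows at least
  linearly in \<open>K\<close>, which beats the logarithmic growth of \<open>log det K\<close>, so the minimum is attained
  (\<open>MLE_exists_of_no_annihilator\<close>).\<close>

section \<open>Polynomial functions along lines\<close>

text \<open>The total degree of a polynomial function, read off from its restrictions to lines, so that sums,
  products and zeros are handled by univariate polynomials.\<close>

definition line_degree_le :: "nat \<Rightarrow> ('a::real_normed_vector \<Rightarrow> real) \<Rightarrow> bool" where
  "line_degree_le D f \<longleftrightarrow>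
     (\<forall>x e. \<exists>q :: real poly. degree q \<le> D \<and> (\<forall>t. f (x + t *\<^sub>R e) = poly q t))"

lemma line_degree_le_const: "line_degree_le D (\<lambda>x. c)"
  unfolding line_degree_le_def by (auto intro!: exI[of _ "[:c:]"])

lemma line_degree_le_linear:
  assumes "bounded_linear f" shows "line_degree_le 1 f"
  unfolding line_degree_le_def
proof (intro allI)
  fix x e
  interpret bounded_linear f by fact
  show "\<exists>q :: real poly. degree q \<le> 1 \<and> (\<forall>t. f (x + t *\<^sub>R e) = poly q t)"
    by (rule exI[of _ "[:f x, f e:]"]) (auto simp: add scaleR)
qed

lemma line_degree_le_mono:
  assumes "line_degree_le D f" "D \<le> E" shows "line_degree_le E f"
  using assms unfolding line_degree_le_def by (meson order_trans)

lemma line_degree_le_add: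
  assumes "line_degree_le D f" "line_degree_le D g"
  shows "line_degree_le D (\<lambda>x. f x + g x)"
  unfolding line_degree_le_def
proof (intro allI)
  fix x e
  obtain p q :: "real poly" where "degree p \<le> D" "\<And>t. f (x + t *\<^sub>R e) = poly p t"
    "degree q \<le> D" "\<And>t. g (x + t *\<^sub>R e) = poly q t"
    using assms unfolding line_degree_le_def by meson
  then show "\<exists>q :: real poly. degree q \<le> D \<and> (\<forall>t. f (x + t *\<^sub>R e) + g (x + t *\<^sub>R e) = poly q t)"
    by (intro exI[of _ "p + q"]) (auto intro: degree_add_le)
qed

lemma line_degree_le_mult:
  assumes "line_degree_le D f" "line_degree_le E g"
  shows "line_degree_le (D + E) (\<lambda>x. f x * g x)"
  unfolding line_degree_le_def
proof (intro allI)
  fix x e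
  obtain p q :: "real poly" where "degree p \<le> D" "\<And>t. f (x + t *\<^sub>R e) = poly p t"
    "degree q \<le> E" "\<And>t. g (x + t *\<^sub>R e) = poly q t"
    using assms unfolding line_degree_le_def by meson
  then show "\<exists>q :: real poly. degree q \<le> D + E \<and> (\<forall>t. f (x + t *\<^sub>R e) * g (x + t *\<^sub>R e) = poly q t)"
    by (intro exI[of _ "p * q"]) (auto intro: order_trans[OF degree_mult_le] add_mono)
qed

lemma line_degree_le_sum:
  assumes "finite I" "\<And>i. i \<in> I \<Longrightarrow> line_degree_le D (f i)"
  shows "line_degree_le D (\<lambda>x. \<Sum>i\<in>I. f i x)"
  using assms by (induction I rule: finite_induct) (auto intro: line_degree_le_const line_degree_le_add)

lemma line_degree_le_prod:
  assumes "finite I" "\<And>i. i \<in> I \<Longrightarrow> line_degree_le D (f i)"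
  shows "line_degree_le (D * card I) (\<lambda>x. \<Prod>i\<in>I. f i x)"
  using assms
  by (induction I rule: finite_induct) (auto intro: line_degree_le_const line_degree_le_mult)

lemma real_polynomial_function_line_degree:
  assumes "real_polynomial_function f" shows "\<exists>D. line_degree_le D f"
  using assms
proof (induction f rule: real_polynomial_function.induct)
  case (linear f)
  then show ?case using line_degree_le_linear by blast
next
  case (const c)
  show ?case using line_degree_le_const by blast
next
  case (add f g)
  then obtain D E where "line_degree_le D f" "line_degree_le E g" by blast
  then have "line_degree_le (max D E) f" "line_degree_le (max D E) g"
    by (auto intro: line_degree_le_mono)
  then show ?case using line_degree_le_add by blast
next
  case (mult f g)
  then show ?case using line_degree_le_mult by blast
qed

lemma real_polynomial_function_on_line:
  assumes "real_polynomial_function f"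
  obtains q :: "real poly" where "\<And>t. f (x + t *\<^sub>R e) = poly q t"
  using real_polynomial_function_line_degree[OF assms] unfolding line_degree_le_def by metis

lemma real_polynomial_function_zero_on_open:
  assumes f: "real_polynomial_function f" and "open U" "U \<noteq> {}" and zero: "\<And>x. x \<in> U \<Longrightarrow> f x = 0"
  shows "f y = 0"
proof -
  obtain a where a: "a \<in> U" using assms by blast
  obtain q :: "real poly" where q: "\<And>t. f (a + t *\<^sub>R (y - a)) = poly q t"
    using real_polynomial_function_on_line[OF f] by metis
  have "open ((\<lambda>t::real. a + t *\<^sub>R (y - a)) -` U)"
    by (intro open_vimage assms continuous_intros)
  moreover have "0 \<in> ((\<lambda>t::real. a + t *\<^sub>R (y - a)) -` U)" using a by simp
  ultimately obtain \<epsilon> where "\<epsilon> > 0" and \<epsilon>: "ball 0 \<epsilon> \<subseteq> ((\<lambda>t::real. a + t *\<^sub>R (y - a)) -` U)"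
    by (meson open_contains_ball)
  have "infinite (ball (0::real) \<epsilon>)"
    using \<open>\<epsilon> > 0\<close> by (simp add: ball_eq_greaterThanLessThan infinite_Ioo)
  moreover have "ball 0 \<epsilon> \<subseteq> {t. poly q t = 0}"
    using \<epsilon> zero q by fastforce
  ultimately have "infinite {t. poly q t = 0}" using finite_subset by blast
  then have "q = 0" using poly_roots_finite by blast
  then show ?thesis using q[of 1] by simp
qed

text \<open>The polynomial functions form an integral domain: join a point where one factor is nonzero to a
  point where the other is, and compare the two univariate restrictions.\<close>

lemma real_polynomial_function_common_nonzero:
  assumes "finite I" "\<And>i. i \<in> I \<Longrightarrow> real_polynomial_function (f i)"
    "\<And>i. i \<in> I \<Longrightarrow> \<exists>x. f i x \<noteq> 0"
  shows "\<exists>x. \<forall>i\<in>I. f i x \<noteq> 0"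
proof -
  have "\<exists>x. (\<Prod>i\<in>I. f i x) \<noteq> 0"
    using assms
  proof (induction I rule: finite_induct)
    case (insert j I)
    then obtain a b where a: "(\<Prod>i\<in>I. f i a) \<noteq> 0" and b: "f j b \<noteq> 0" by blast
    have "real_polynomial_function (\<lambda>x. \<Prod>i\<in>I. f i x)" "real_polynomial_function (f j)"
      using insert by auto
    then obtain p q :: "real poly" where
      p: "\<And>t. (\<Prod>i\<in>I. f i (a + t *\<^sub>R (b - a))) = poly p t" and
      q: "\<And>t. f j (a + t *\<^sub>R (b - a)) = poly q t"
      by (metis real_polynomial_function_on_line)
    have "p \<noteq> 0" using p[of 0] a by auto
    moreover have "q \<noteq> 0" using q[of 1] b by auto
    ultimately have "finite {t. poly (q * p) t = 0}"
      using poly_roots_finite by (metis no_zero_divisors)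
    then obtain t where "poly (q * p) t \<noteq> 0"
      using infinite_UNIV_char_0 by (metis (mono_tags, lifting) UNIV_eq_I mem_Collect_eq)
    then have "f j (a + t *\<^sub>R (b - a)) * (\<Prod>i\<in>I. f i (a + t *\<^sub>R (b - a))) \<noteq> 0"
      by (simp add: p q)
    then show ?case using insert.hyps by auto
  qed auto
  then show ?thesis using assms(1) by auto
qed

text \<open>A univariate polynomial of degree at most \<open>E\<close> with the \<open>E + 1\<close> roots \<open>0, \<dots>, E\<close> is zero; this
  frees the coordinates from the grid one at a time.\<close>

lemma line_degree_le_zero_on_grid:
  fixes f :: "'a::euclidean_space \<Rightarrow> real"
  assumes "line_degree_le E f"
    and grid: "\<And>c. (\<And>i. i \<in> Basis \<Longrightarrow> c i \<in> {0..E}) \<Longrightarrow> f (\<Sum>i\<in>Basis. real (c i) *\<^sub>R i) = 0"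
  shows "f x = 0"
proof -
  have "f x = 0" if "finite B" "B \<subseteq> Basis" "\<forall>i\<in>Basis - B. \<exists>c\<in>{0..E}. x \<bullet> i = real c" for B x
    using that
  proof (induction B arbitrary: x rule: finite_induct)
    case empty
    then obtain c where c: "\<And>i. i \<in> Basis \<Longrightarrow> c i \<in> {0..E} \<and> x \<bullet> i = real (c i)"
      by (metis Diff_empty)
    have "x = (\<Sum>i\<in>Basis. real (c i) *\<^sub>R i)"
      using c by (subst euclidean_representation[symmetric]) (auto intro!: sum.cong)
    then show ?case using grid[of c] c by auto
  next
    case (insert b B)
    let ?y = "x - (x \<bullet> b) *\<^sub>R b"
    obtain q :: "real poly" where "degree q \<le> E" and q: "\<And>t. f (?y + t *\<^sub>R b) = poly q t"
      using assms(1) unfolding line_degree_le_def by metis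
    have "poly q (real k) = 0" if "k \<in> {0..E}" for k
    proof -
      have "f (?y + real k *\<^sub>R b) = 0"
      proof (rule insert.IH)
        show "\<forall>i\<in>Basis - B. \<exists>c\<in>{0..E}. (?y + real k *\<^sub>R b) \<bullet> i = real c"
          using insert.prems that
          by (auto simp: inner_simps inner_Basis)
      qed (use insert.prems in auto)
      then show ?thesis using q by simp
    qed
    then have sub: "real ` {0..E} \<subseteq> {t. poly q t = 0}" by auto
    have "q = 0"
    proof (rule ccontr)
      assume "q \<noteq> 0"
      then have "card (real ` {0..E}) \<le> card {t. poly q t = 0}"
        using sub poly_roots_finite by (intro card_mono) auto
      moreover have "card {t. poly q t = 0} \<le> degree q"
        using \<open>q \<noteq> 0\<close> card_poly_roots_bound by blast
      moreover have "card (real ` {0..E}) = Suc E" by (subst card_image) auto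
      ultimately show False using \<open>degree q \<le> E\<close> by simp
    qed
    then show ?case using q[of "x \<bullet> b"] by simp
  qed
  from this[of Basis x] show ?thesis by auto
qed

section \<open>Counting polynomials: algebraic dependence\<close>

text \<open>Gaussian elimination of one equation and one unknown.\<close>

lemma underdetermined_system:
  fixes M :: "'a \<Rightarrow> 'b \<Rightarrow> 'k::field"
  assumes "finite A" "finite B" "card A < card B"
  shows "\<exists>c. (\<exists>b\<in>B. c b \<noteq> 0) \<and> (\<forall>a\<in>A. (\<Sum>b\<in>B. M a b * c b) = 0)"
  using assms
proof (induction A arbitrary: B M rule: finite_induct)
  case empty
  then have "B \<noteq> {}" by auto
  then show ?case by (intro exI[of _ "\<lambda>_. 1"]) auto
next
  case (insert a A)
  show ?case
  proof (cases "\<forall>b\<in>B. M a b = 0")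
    case True
    have "card A < card B" using insert by simp
    from insert.IH[OF insert.prems(1) this] show ?thesis using True by simp
  next
    case False
    then obtain b0 where b0: "b0 \<in> B" "M a b0 \<noteq> 0" by blast
    let ?B = "B - {b0}"
    let ?M = "\<lambda>x b. M x b - M x b0 * M a b / M a b0"
    have "finite ?B" "card A < card ?B" using insert b0 by auto
    from insert.IH[OF this, of ?M] obtain c where
      c: "\<exists>b\<in>?B. c b \<noteq> 0" "\<And>x. x \<in> A \<Longrightarrow> (\<Sum>b\<in>?B. ?M x b * c b) = 0" by blast
    define s where "s = (\<Sum>b\<in>?B. M a b * c b)"
    define d where "d = c(b0 := - s / M a b0)"
    have split: "(\<Sum>b\<in>B. M x b * d b) = M x b0 * (- s / M a b0) + (\<Sum>b\<in>?B. M x b * c b)" for x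
      using b0 insert.prems by (subst sum.remove[of B b0]) (auto simp: d_def intro!: sum.cong)
    have "(\<Sum>b\<in>B. M x b * d b) = 0" if "x \<in> A" for x
    proof -
      have "0 = (\<Sum>b\<in>?B. M x b * c b - M x b0 / M a b0 * (M a b * c b))"
        unfolding c(2)[OF that, symmetric] by (intro sum.cong) (auto simp: algebra_simps)
      also have "\<dots> = (\<Sum>b\<in>?B. M x b * c b) - M x b0 / M a b0 * s"
        by (simp add: s_def sum_subtractf sum_distrib_left)
      finally have "0 = (\<Sum>b\<in>?B. M x b * c b) - M x b0 / M a b0 * s" .
      then show ?thesis by (simp add: split)
    qed
    moreover have "(\<Sum>b\<in>B. M a b * d b) = 0" using b0 by (simp add: split s_def)
    moreover have "\<exists>b\<in>B. d b \<noteq> 0" using c(1) by (auto simp: d_def)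
    ultimately show ?thesis by blast
  qed
qed

text \<open>More than \<open>m\<close> polynomials in \<open>m\<close> variables satisfy a polynomial relation. The relation \<open>G\<close> is sought
  in the span of the Lagrange basis polynomials of the grid \<open>{0..N}\<^sup>K\<close>, a space of dimension
  \<open>(N + 1)\<^sup>k\<close> with \<open>k = card K\<close>. The composition with \<open>F\<close> has degree at most \<open>E = D N k\<close>, so it
  vanishes as soon as it vanishes at the \<open>(E + 1)\<^sup>m\<close> points of a grid, which are fewer conditions than
  unknowns once \<open>N\<close> is large. In the Lagrange basis the coefficients of \<open>G\<close> are, up to nonzero factors, its
  values on the grid, so \<open>G\<close> is visibly nonzero.\<close>

lemma algebraically_dependent:
  fixes F :: "'a::euclidean_space \<Rightarrow> 'c::euclidean_space"
  assumes F: "polynomial_function F" and K: "K \<subseteq> Basis" "DIM('a) < card K"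
  shows "\<exists>G. real_polynomial_function G \<and> (\<forall>x. G (F x) = 0) \<and> (\<exists>y\<in>span K. G y \<noteq> 0)"
proof -
  have finK: "finite K" using finite_subset[OF K(1) finite_Basis] .
  have pF: "real_polynomial_function (\<lambda>x. F x \<bullet> k)" if "k \<in> K" for k
    using F that K(1) by (auto simp: polynomial_function_iff_Basis_inner)
  then have "\<forall>k\<in>K. \<exists>D. line_degree_le D (\<lambda>x. F x \<bullet> k)"
    using real_polynomial_function_line_degree by blast
  then obtain d where d: "\<And>k. k \<in> K \<Longrightarrow> line_degree_le (d k) (\<lambda>x. F x \<bullet> k)"
    using bchoice[of K "\<lambda>k D. line_degree_le D (\<lambda>x. F x \<bullet> k)"] by blast
  define D where "D = (\<Sum>k\<in>K. d k)"
  have D: "line_degree_le D (\<lambda>x. F x \<bullet> k)" if "k \<in> K" for k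
    using line_degree_le_mono[OF d[OF that]] that finK by (simp add: D_def member_le_sum)
  \<comment> \<open>This choice gives \<open>(E + 1)\<^sup>m \<le> (D k + 1)\<^sup>m (N + 1)\<^sup>m = N (N + 1)\<^sup>m < (N + 1)\<^sup>m\<^sup>+\<^sup>1\<close>.\<close>
  define N where "N = (D * card K + 1) ^ DIM('a)"
  define E where "E = D * N * card K"
  define B where "B = (K \<rightarrow>\<^sub>E {0..N})"
  define A where "A = ((Basis :: 'a set) \<rightarrow>\<^sub>E {0..E})"
  \<comment> \<open>The unnormalised Lagrange polynomial that vanishes at all grid points except \<open>\<beta>\<close>.\<close>
  define W where "W = (\<lambda>\<beta> y. \<Prod>k\<in>K. \<Prod>a\<in>{0..N} - {\<beta> k}. y \<bullet> k - real a)"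
  have fin: "finite A" "finite B" unfolding A_def B_def using finK by (auto intro: finite_PiE)
  have "card A = (E + 1) ^ DIM('a)" by (simp add: A_def card_PiE)
  also have "\<dots> \<le> ((D * card K + 1) * (N + 1)) ^ DIM('a)"
    by (intro power_mono) (auto simp: E_def algebra_simps)
  also have "\<dots> = N * (N + 1) ^ DIM('a)" unfolding power_mult_distrib N_def ..
  also have "\<dots> < (N + 1) ^ (DIM('a) + 1)" by simp
  also have "\<dots> \<le> (N + 1) ^ card K" using K(2) by (intro power_increasing) auto
  also have "\<dots> = card B" using finK by (simp add: B_def card_PiE)
  finally have "card A < card B" .
  from underdetermined_system[OF fin this, of "\<lambda>g \<beta>. W \<beta> (F (\<Sum>i\<in>Basis. real (g i) *\<^sub>R i))"]
  obtain c where c: "\<exists>\<beta>\<in>B. c \<beta> \<noteq> 0"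
    "\<And>g. g \<in> A \<Longrightarrow> (\<Sum>\<beta>\<in>B. W \<beta> (F (\<Sum>i\<in>Basis. real (g i) *\<^sub>R i)) * c \<beta>) = 0"
    by blast
  define G where "G = (\<lambda>y. \<Sum>\<beta>\<in>B. W \<beta> y * c \<beta>)"
  have "real_polynomial_function G"
    unfolding G_def W_def
    by (intro real_polynomial_function_sum real_polynomial_function.intros(4)
        real_polynomial_function_prod real_polynomial_function_diff
        real_polynomial_function.intros(1) bounded_linear_inner_left fin finK finite_Diff
        finite_atLeastAtMost real_polynomial_function.intros(2))
  moreover have "G (F x) = 0" for x
  proof (rule line_degree_le_zero_on_grid[where f = "\<lambda>x. G (F x)" and E = E])
    have W: "line_degree_le E (\<lambda>x. W \<beta> (F x))" if "\<beta> \<in> B" for \<beta>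
    proof -
      have "line_degree_le (D * N) (\<lambda>x. \<Prod>a\<in>{0..N} - {\<beta> k}. F x \<bullet> k - real a)" if "k \<in> K" for k
      proof -
        have "\<beta> k \<in> {0..N}" using PiE_mem[OF _ that] \<open>\<beta> \<in> B\<close> unfolding B_def by fast
        then have "card ({0..N} - {\<beta> k}) = N" by (subst card_Diff_singleton) auto
        moreover have "line_degree_le (D * card ({0..N} - {\<beta> k}))
            (\<lambda>x. \<Prod>a\<in>{0..N} - {\<beta> k}. F x \<bullet> k - real a)"
          using line_degree_le_add[OF D[OF that] line_degree_le_const]
          by (intro line_degree_le_prod) (auto simp: diff_conv_add_uminus simp del: add_uminus_conv_diff)
        ultimately show ?thesis by simp
      qed
      then show ?thesis unfolding W_def E_def by (intro line_degree_le_prod finK) auto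
    qed
    have "line_degree_le (E + 0) (\<lambda>x. W \<beta> (F x) * c \<beta>)" if "\<beta> \<in> B" for \<beta>
      by (intro line_degree_le_mult line_degree_le_const W that)
    then show "line_degree_le E (\<lambda>x. G (F x))"
      unfolding G_def by (intro line_degree_le_sum fin) auto
  next
    fix g :: "'a \<Rightarrow> nat" assume g: "\<And>i. i \<in> Basis \<Longrightarrow> g i \<in> {0..E}"
    have "restrict g Basis \<in> A" using g by (auto simp: A_def)
    moreover have "(\<Sum>i\<in>Basis. real (restrict g Basis i) *\<^sub>R i) = (\<Sum>i\<in>Basis. real (g i) *\<^sub>R i)"
      by (intro sum.cong) auto
    ultimately show "G (F (\<Sum>i\<in>Basis. real (g i) *\<^sub>R i)) = 0"
      using c(2) unfolding G_def by metis
  qed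
  moreover have "\<exists>y\<in>span K. G y \<noteq> 0"
  proof -
    obtain \<beta> where \<beta>: "\<beta> \<in> B" "c \<beta> \<noteq> 0" using c(1) by blast
    define y where "y = (\<Sum>k\<in>K. real (\<beta> k) *\<^sub>R k)"
    have y: "y \<bullet> k = real (\<beta> k)" if "k \<in> K" for k
    proof -
      have "y \<bullet> k = (\<Sum>j\<in>K. if j = k then real (\<beta> j) else 0)"
        unfolding y_def inner_sum_left using K(1) that
        by (intro sum.cong) (auto simp: inner_Basis subset_iff)
      then show ?thesis using that finK by simp
    qed
    have "W \<gamma> y = 0" if \<gamma>: "\<gamma> \<in> B" "\<gamma> \<noteq> \<beta>" for \<gamma>
    proof -
      obtain k where k: "k \<in> K" "\<gamma> k \<noteq> \<beta> k"
        using PiE_ext[of \<gamma> K "\<lambda>_. {0..N}" \<beta>] \<gamma> \<beta>(1) unfolding B_def by auto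
      have "(\<Prod>a\<in>{0..N} - {\<gamma> k}. y \<bullet> k - real a) = 0"
        using k \<beta>(1) y[OF k(1)] by (auto simp: B_def intro!: bexI[of _ "\<beta> k"])
      then show ?thesis unfolding W_def using k(1) finK by auto
    qed
    then have "G y = W \<beta> y * c \<beta>"
      unfolding G_def using \<beta> fin by (subst sum.remove[of _ \<beta>]) auto
    moreover have "W \<beta> y \<noteq> 0" using y finK by (auto simp: W_def)
    ultimately have "G y \<noteq> 0" using \<beta> by simp
    moreover have "y \<in> span K" unfolding y_def by (intro span_sum span_scale span_base)
    ultimately show ?thesis by blast
  qed
  ultimately show ?thesis by blast
qed

section \<open>The Jacobian criterion\<close>

lemma real_polynomial_function_has_derivative:
  assumes "real_polynomial_function f"
  obtains f' where "\<And>x. (f has_derivative f' x) (at x)" "\<And>v. real_polynomial_function (\<lambda>x. f' x v)"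
proof -
  have "\<exists>f'. (\<forall>x. (f has_derivative f' x) (at x)) \<and> (\<forall>v. real_polynomial_function (\<lambda>x. f' x v))"
    using assms
  proof (induction f rule: real_polynomial_function.induct)
    case (linear f)
    then show ?case by (intro exI[of _ "\<lambda>_. f"]) (auto intro: bounded_linear_imp_has_derivative)
  next
    case (const c)
    show ?case by (intro exI[of _ "\<lambda>_ _. 0"]) auto
  next
    case (add f g)
    then obtain f' g' where "\<And>x. (f has_derivative f' x) (at x)" "\<And>v. real_polynomial_function (\<lambda>x. f' x v)"
      "\<And>x. (g has_derivative g' x) (at x)" "\<And>v. real_polynomial_function (\<lambda>x. g' x v)" by metis
    then show ?case
      by (intro exI[of _ "\<lambda>x v. f' x v + g' x v"]) (auto intro: has_derivative_add)
  next
    case (mult f g)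
    then obtain f' g' where "\<And>x. (f has_derivative f' x) (at x)" "\<And>v. real_polynomial_function (\<lambda>x. f' x v)"
      "\<And>x. (g has_derivative g' x) (at x)" "\<And>v. real_polynomial_function (\<lambda>x. g' x v)" by metis
    then show ?case using mult.hyps
      by (intro exI[of _ "\<lambda>x v. f x * g' x v + f' x v * g x"]) (auto intro!: has_derivative_mult real_polynomial_function.intros(3,4))
  qed
  then show ?thesis using that by blast
qed

text \<open>A stand-in for the minimal polynomial of the coordinate in direction \<open>e\<close>. If \<open>G\<close> vanishes along
  \<open>\<Phi>\<close> but not identically on the line through some \<open>\<Phi> x0\<close> in direction \<open>e\<close>, its iterated
  derivatives \<open>T k\<close> in direction \<open>e\<close> cannot all vanish along \<open>\<Phi>\<close>, by the Taylor expansion on that line. The last one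
  before the first nonvanishing one is a relation with a nonvanishing partial derivative; this is
  where characteristic zero enters.\<close>

lemma relation_with_nonzero_partial:
  fixes \<Phi> :: "'a \<Rightarrow> 'c::real_normed_vector"
  assumes G: "real_polynomial_function G" "\<And>x. G (\<Phi> x) = 0" and nz: "G (\<Phi> x0 + t0 *\<^sub>R e) \<noteq> 0"
  obtains H H' where "\<And>y. (H has_derivative H' y) (at y)"
    "\<And>v. real_polynomial_function (\<lambda>y. H' y v)" "\<And>x. H (\<Phi> x) = 0" "\<exists>x. H' (\<Phi> x) e \<noteq> 0"
proof -
  have "\<exists>g'. (\<forall>x. (g has_derivative g' x) (at x)) \<and> (\<forall>v. real_polynomial_function (\<lambda>x. g' x v))"
    if "real_polynomial_function g" for g :: "'c \<Rightarrow> real"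
    using real_polynomial_function_has_derivative[OF that] by metis
  then obtain \<Delta> where \<Delta>: "\<And>g :: 'c \<Rightarrow> real. real_polynomial_function g \<Longrightarrow>
      (\<forall>x. (g has_derivative \<Delta> g x) (at x)) \<and> (\<forall>v. real_polynomial_function (\<lambda>x. \<Delta> g x v))"
    by metis
  define T where "T = (\<lambda>k. ((\<lambda>g x. \<Delta> g x e) ^^ k) G)"
  have T_Suc: "T (Suc k) = (\<lambda>x. \<Delta> (T k) x e)" for k by (simp add: T_def)
  have T_poly: "real_polynomial_function (T k)" for k
    by (induction k) (use G(1) \<Delta> in \<open>auto simp: T_Suc, simp add: T_def\<close>)
  obtain q :: "real poly" where q: "\<And>t. G (\<Phi> x0 + t *\<^sub>R e) = poly q t"
    using real_polynomial_function_on_line[OF G(1)] by metis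
  have T_line: "T k (\<Phi> x0 + t *\<^sub>R e) = poly ((pderiv ^^ k) q) t" for k t
  proof (induction k arbitrary: t)
    case 0
    then show ?case using q by (simp add: T_def)
  next
    case (Suc k)
    have "(T k has_derivative \<Delta> (T k) (\<Phi> x0 + t *\<^sub>R e)) (at (\<Phi> x0 + t *\<^sub>R e))"
      using \<Delta>[OF T_poly] by blast
    moreover have "((\<lambda>t. \<Phi> x0 + t *\<^sub>R e) has_derivative (\<lambda>s. s *\<^sub>R e)) (at t)"
      by (auto intro!: derivative_eq_intros)
    ultimately have "((\<lambda>t. T k (\<Phi> x0 + t *\<^sub>R e)) has_derivative
        (\<lambda>s. \<Delta> (T k) (\<Phi> x0 + t *\<^sub>R e) (s *\<^sub>R e))) (at t)"
      by (rule has_derivative_compose[rotated])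
    moreover have "((\<lambda>t. T k (\<Phi> x0 + t *\<^sub>R e)) has_derivative
        (\<lambda>s. poly (pderiv ((pderiv ^^ k) q)) t * s)) (at t)"
      unfolding Suc.IH using poly_DERIV[of "(pderiv ^^ k) q" t] by (simp add: has_field_derivative_def)
    ultimately have "(\<lambda>s. \<Delta> (T k) (\<Phi> x0 + t *\<^sub>R e) (s *\<^sub>R e)) =
        (\<lambda>s. poly (pderiv ((pderiv ^^ k) q)) t * s)"
      by (rule has_derivative_unique)
    from fun_cong[OF this, of 1] show ?case by (simp add: T_Suc)
  qed
  have "q \<noteq> 0" using q[of t0] nz by auto
  then obtain k where "coeff q k \<noteq> 0" by (auto simp: poly_eq_iff)
  then have "coeff ((pderiv ^^ k) q) 0 \<noteq> 0"
    by (simp add: coeff_higher_pderiv pochhammer_fact[symmetric])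
  then have "T k (\<Phi> x0) \<noteq> 0" using T_line[of k 0] by (simp add: poly_0_coeff_0)
  then have ex: "\<exists>k x. T k (\<Phi> x) \<noteq> 0" by blast
  define k where "k = (LEAST k. \<exists>x. T k (\<Phi> x) \<noteq> 0)"
  have k: "\<exists>x. T k (\<Phi> x) \<noteq> 0" unfolding k_def using ex by (rule LeastI_ex)
  have "T 0 (\<Phi> x) = 0" for x using G(2) by (simp add: T_def)
  then have "k \<noteq> 0" using k by metis
  then obtain j where j: "k = Suc j" by (cases k) auto
  have "j < k" using j by simp
  then have "\<not> (\<exists>x. T j (\<Phi> x) \<noteq> 0)" unfolding k_def by (rule not_less_Least)
  then show ?thesis
    using that[of "T j" "\<Delta> (T j)"] \<Delta>[OF T_poly[of j]] k by (auto simp: j T_Suc)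
qed

text \<open>Adjoin coordinates \<open>x\<^sub>i\<close>, \<open>i \<in> J\<close>, to the components of \<open>f\<close> as long as the family stays
  algebraically independent; the components alone are independent because a polynomial vanishing
  on the image of \<open>f\<close> vanishes on an open set. By counting, \<open>DIM('b) + card J \<le> DIM('a)\<close>. Maximality makes each
  remaining coordinate algebraic over the family, and differentiating its equation at a generic
  point shows that the derivative of \<open>f\<close> is injective on the span of the coordinates outside \<open>J\<close>. That
  span has dimension at least \<open>DIM('b)\<close>, so the derivative is onto.\<close>

theorem polynomial_image_interior_imp_surj_derivative:
  fixes f :: "'a::euclidean_space \<Rightarrow> 'b::euclidean_space"
  assumes f: "polynomial_function f" and int: "interior (range f) \<noteq> {}"
  shows "\<exists>x f'. (f has_derivative f') (at x) \<and> surj f'"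
proof -
  define \<pi> where "\<pi> = (\<lambda>J x. \<Sum>i\<in>J. (x \<bullet> i) *\<^sub>R (i :: 'a))"
  have bl\<pi>: "bounded_linear (\<pi> J)" for J
    unfolding \<pi>_def by (intro bounded_linear_sum bounded_linear_scaleR_const bounded_linear_inner_left)
  define indep where "indep = (\<lambda>J. \<forall>G :: 'b \<times> 'a \<Rightarrow> real. real_polynomial_function G \<longrightarrow>
      (\<forall>x. G (f x, \<pi> J x) = 0) \<longrightarrow> (\<forall>y x. G (y, \<pi> J x) = 0))"
  have indep_empty: "indep {}"
    unfolding indep_def
  proof (intro allI impI)
    fix G :: "'b \<times> 'a \<Rightarrow> real" and y :: 'b and x :: 'a
    assume G: "real_polynomial_function G" and zero: "\<forall>x. G (f x, \<pi> {} x) = 0"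
    have "polynomial_function (\<lambda>y :: 'b. (y, 0 :: 'a))"
      by (intro polynomial_function_bounded_linear bounded_linear_Pair bounded_linear_ident bounded_linear_zero)
    from real_polynomial_function_compose[OF this G]
    have "real_polynomial_function (\<lambda>y. G (y, 0))" by (simp add: o_def)
    moreover have "G (y, 0) = 0" if "y \<in> interior (range f)" for y
      using that interior_subset zero by (fastforce simp: \<pi>_def)
    ultimately have "G (y, 0) = 0"
      using real_polynomial_function_zero_on_open[of _ "interior (range f)"] int by blast
    then show "G (y, \<pi> {} x) = 0" by (simp add: \<pi>_def)
  qed
  obtain J where J: "J \<subseteq> Basis" "indep J" and max: "\<And>i. i \<in> Basis - J \<Longrightarrow> \<not> indep (insert i J)"
  proof -
    have "finite {J. J \<subseteq> Basis \<and> indep J}" "{J. J \<subseteq> Basis \<and> indep J} \<noteq> {}"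
      using indep_empty by auto
    from finite_has_maximal[OF this] obtain J where
      "J \<subseteq> Basis \<and> indep J" "\<forall>J'\<in>{J. J \<subseteq> Basis \<and> indep J}. J \<subseteq> J' \<longrightarrow> J = J'" by auto
    then have J: "J \<subseteq> Basis" "indep J"
      and maximal: "\<And>J'. J' \<subseteq> Basis \<Longrightarrow> indep J' \<Longrightarrow> J \<subseteq> J' \<Longrightarrow> J = J'" by auto
    show ?thesis
    proof (rule that[OF J])
      fix i assume i: "i \<in> Basis - J"
      then have "J \<noteq> insert i J" "insert i J \<subseteq> Basis" using J(1) by auto
      then show "\<not> indep (insert i J)" using maximal[of "insert i J"] by auto
    qed
  qed
  have finJ: "finite J" using finite_subset[OF J(1) finite_Basis] .
  have poly\<Phi>: "polynomial_function (\<lambda>x. (f x, \<pi> I x))" for I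
  proof -
    have "polynomial_function (\<lambda>y :: 'b. (y, 0 :: 'a))" "polynomial_function (\<lambda>x. (0 :: 'b, \<pi> I x))"
      by (rule polynomial_function_bounded_linear,
          intro bounded_linear_Pair bounded_linear_ident bounded_linear_zero bl\<pi>)+
    from polynomial_function_add[OF polynomial_function_compose[OF f this(1)] this(2)]
    show ?thesis by simp
  qed
  have count: "DIM('b) + card J \<le> DIM('a)"
  proof (rule ccontr)
    assume less: "\<not> DIM('b) + card J \<le> DIM('a)"
    let ?K = "(\<lambda>b. (b, 0)) ` (Basis :: 'b set) \<union> (\<lambda>i. (0, i)) ` J"
    have "card ?K = DIM('b) + card J"
      by (subst card_Un_disjoint) (use finJ J(1) in \<open>auto simp: card_image inj_on_def\<close>)
    then have "DIM('a) < card ?K" using less by simp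
    moreover have "?K \<subseteq> Basis" using J(1) by (auto simp: Basis_prod_def)
    ultimately have "\<exists>G. real_polynomial_function G \<and> (\<forall>x. G (f x, \<pi> J x) = 0) \<and> (\<exists>y\<in>span ?K. G y \<noteq> 0)"
      by (intro algebraically_dependent[OF poly\<Phi>[of J]])
    then obtain G where G: "real_polynomial_function G" "\<And>x. G (f x, \<pi> J x) = 0"
      and nz: "\<exists>y\<in>span ?K. G y \<noteq> 0"
      by (elim exE conjE) simp
    have "subspace {p :: 'b \<times> 'a. snd p = \<pi> J (snd p)}"
      by (auto simp: subspace_def linear_simps[OF bl\<pi>])
    moreover have "\<pi> J i = i" if "i \<in> J" for i
    proof -
      have "\<pi> J i = (\<Sum>j\<in>J. if j = i then i else 0)"
        unfolding \<pi>_def using J(1) that by (intro sum.cong) (auto simp: inner_Basis subset_iff)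
      then show ?thesis using that finJ by simp
    qed
    then have "?K \<subseteq> {p. snd p = \<pi> J (snd p)}" by (auto simp: \<pi>_def)
    ultimately have "span ?K \<subseteq> {p. snd p = \<pi> J (snd p)}" by (rule span_minimal[rotated])
    then have "\<exists>y x. G (y, \<pi> J x) \<noteq> 0" using nz by (metis (mono_tags, lifting) mem_Collect_eq prod.collapse subsetD)
    then show False using J(2) G unfolding indep_def by blast
  qed
  have "\<exists>H H'. (\<forall>y. (H has_derivative H' y) (at y)) \<and> (\<forall>v. real_polynomial_function (\<lambda>y. H' y v)) \<and>
      (\<forall>x. H (f x, \<pi> (insert i J) x) = (0 :: real)) \<and> (\<exists>x. H' (f x, \<pi> (insert i J) x) (0, i) \<noteq> 0)"
    if i: "i \<in> Basis - J" for i
  proof -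
    have \<pi>_insert: "\<pi> (insert i J) x = \<pi> J x + (x \<bullet> i) *\<^sub>R i" for x
      using i finJ by (simp add: \<pi>_def)
    obtain G y x where G: "real_polynomial_function G" "\<And>x. G (f x, \<pi> (insert i J) x) = 0"
      and nz: "G (y, \<pi> (insert i J) x) \<noteq> 0"
      using max[OF i] unfolding indep_def by blast
    have "\<exists>x0 t0. G ((f x0, \<pi> (insert i J) x0) + t0 *\<^sub>R (0, i)) \<noteq> 0"
    proof (rule ccontr)
      assume "\<not> ?thesis"
      then have zero: "G (f z, \<pi> J z + (z \<bullet> i) *\<^sub>R i + t *\<^sub>R i) = 0" for z t
        by (simp add: \<pi>_insert)
      \<comment> \<open>Freezing coordinate \<open>i\<close> at its value at \<open>x\<close> turns \<open>G\<close> into a relation for \<open>J\<close> itself, and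
        independence of that family kills it.\<close>
      let ?g = "\<lambda>p. G (fst p, snd p + (x \<bullet> i) *\<^sub>R i)"
      have "polynomial_function (\<lambda>p :: 'b \<times> 'a. p + (0, (x \<bullet> i) *\<^sub>R i))"
        by (intro polynomial_function_add polynomial_function_id polynomial_function_const)
      from real_polynomial_function_compose[OF this G(1)]
      have "real_polynomial_function ?g" by (simp add: o_def plus_prod_def)
      moreover have "?g (f z, \<pi> J z) = 0" for z
        using zero[of z "x \<bullet> i - z \<bullet> i"] by (simp add: algebra_simps)
      ultimately have "?g (y, \<pi> J x) = 0" using J(2) unfolding indep_def by blast
      then show False using nz by (simp add: \<pi>_insert)
    qed
    then obtain x0 t0 where "G ((f x0, \<pi> (insert i J) x0) + t0 *\<^sub>R (0, i)) \<noteq> 0" by blast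
    from relation_with_nonzero_partial[of G "\<lambda>x. (f x, \<pi> (insert i J) x)", OF G this]
    show ?thesis by metis
  qed
  then obtain H H' where H: "\<And>i y. i \<in> Basis - J \<Longrightarrow> (H i has_derivative H' i y) (at y)"
    and H'_poly: "\<And>i v. i \<in> Basis - J \<Longrightarrow> real_polynomial_function (\<lambda>y. H' i y v)"
    and H0: "\<And>i x. i \<in> Basis - J \<Longrightarrow> H i (f x, \<pi> (insert i J) x) = (0 :: real)"
    and H'_nz: "\<And>i. i \<in> Basis - J \<Longrightarrow> \<exists>x. H' i (f x, \<pi> (insert i J) x) (0, i) \<noteq> 0"
    by metis
  have "\<exists>x. \<forall>i\<in>Basis - J. H' i (f x, \<pi> (insert i J) x) (0, i) \<noteq> 0"
  proof (rule real_polynomial_function_common_nonzero)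
    show "real_polynomial_function (\<lambda>x. H' i (f x, \<pi> (insert i J) x) (0, i))" if "i \<in> Basis - J" for i
      using real_polynomial_function_compose[OF poly\<Phi> H'_poly[OF that]] by (simp add: o_def)
  qed (use H'_nz in auto)
  then obtain x where x: "\<And>i. i \<in> Basis - J \<Longrightarrow> H' i (f x, \<pi> (insert i J) x) (0, i) \<noteq> 0" by blast
  obtain f' where f': "(f has_derivative f') (at x)"
    using differentiable_at_polynomial_function[OF f] by (auto simp: differentiable_def)
  interpret f': bounded_linear f' using f' by (rule has_derivative_bounded_linear)
  define V where "V = span (Basis - J)"
  have V_J: "v \<bullet> j = 0" if "v \<in> V" "j \<in> J" for v j
  proof -
    have "subspace {v. v \<bullet> j = 0}" by (simp add: subspace_def inner_simps)
    moreover have "Basis - J \<subseteq> {v. v \<bullet> j = 0}"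
      using that J(1) by (auto simp: inner_Basis)
    ultimately have "V \<subseteq> {v. v \<bullet> j = 0}" unfolding V_def by (rule span_minimal[rotated])
    then show ?thesis using that by blast
  qed
  have ker: "v = 0" if "v \<in> V" "f' v = 0" for v
  proof (rule euclidean_eqI)
    fix i :: 'a assume i: "i \<in> Basis"
    show "v \<bullet> i = 0 \<bullet> i"
    proof (cases "i \<in> J")
      case True
      then show ?thesis using V_J that by simp
    next
      case False
      then have i': "i \<in> Basis - J" using i by simp
      let ?p = "(f x, \<pi> (insert i J) x)"
      have "((\<lambda>x. (f x, \<pi> (insert i J) x)) has_derivative (\<lambda>v. (f' v, \<pi> (insert i J) v))) (at x)"
        by (intro has_derivative_Pair f' bounded_linear_imp_has_derivative bl\<pi>)
      from has_derivative_compose[OF this H[OF i']]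
      have "((\<lambda>x. 0) has_derivative (\<lambda>v. H' i ?p (f' v, \<pi> (insert i J) v))) (at x)"
        by (simp add: H0[OF i'])
      then have "(\<lambda>v. H' i ?p (f' v, \<pi> (insert i J) v)) = (\<lambda>v. 0)"
        by (rule has_derivative_unique) (rule has_derivative_const)
      then have "H' i ?p (f' v, \<pi> (insert i J) v) = 0" by meson
      moreover have "\<pi> (insert i J) v = (v \<bullet> i) *\<^sub>R i"
        using False finJ V_J that by (simp add: \<pi>_def)
      moreover have "H' i ?p ((v \<bullet> i) *\<^sub>R (0, i)) = (v \<bullet> i) * H' i ?p (0, i)"
        using linear_simps(5)[OF has_derivative_bounded_linear[OF H[OF i']], of ?p "v \<bullet> i" "(0, i)"]
        by simp
      ultimately have "(v \<bullet> i) * H' i ?p (0, i) = 0" using that by simp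
      then show ?thesis using x[OF i'] by simp
    qed
  qed
  have subV: "subspace V" by (simp add: V_def)
  have "inj_on f' V"
  proof (rule inj_onI)
    fix u v assume uv: "u \<in> V" "v \<in> V" "f' u = f' v"
    then have "u - v \<in> V" "f' (u - v) = 0" using subV by (auto simp: subspace_diff f'.diff)
    then show "u = v" using ker[of "u - v"] by simp
  qed
  then have "dim (f' ` V) = dim V"
    using f'.linear_axioms subV by (intro dim_image_eq) (auto simp: V_def span_span)
  also have "dim V = card (Basis - J)"
    unfolding V_def dim_span by (intro dim_eq_card_independent independent_mono[OF independent_Basis]) auto
  also have "\<dots> = DIM('a) - card J" using J(1) finJ by (simp add: card_Diff_subset)
  finally have "dim (f' ` V) \<ge> DIM('b)" using count by simp
  then have "dim (f' ` V) = DIM('b)" using dim_subset_UNIV[of "f' ` V"] by simp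
  then have "span (f' ` V) = UNIV" by (simp add: dim_eq_full)
  moreover have "subspace (f' ` V)" using f'.linear_axioms subV by (rule linear_subspace_image)
  ultimately have "f' ` V = UNIV" using span_eq_iff by metis
  then have "surj f'" by auto
  then show ?thesis using f' by blast
qed

section \<open>The trace form and the projection onto a subspace\<close>

text \<open>The Euclidean inner product \<open>Tr (A B\<^sup>T)\<close> agrees with the trace form as soon as \<open>B\<close> is symmetric, so the
  projection for the trace form onto a space of symmetric matrices is the Euclidean one, even on
  nonsymmetric arguments.\<close>

lemma inner_matrix_trace:
  assumes "B \<in> sym_mats" shows "trace (A ** B) = A \<bullet> B"
proof -
  have "B $ k $ i = B $ i $ k" for i k
    using assms unfolding sym_mats_def transpose_def by (simp add: vec_eq_iff)
  then show ?thesis by (simp add: trace_def matrix_matrix_mult_def inner_vec_def)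
qed

lemma inner_matrix_mult_left: "(A ** B) \<bullet> C = B \<bullet> (transpose A ** C)"
  for A :: "real^'m^'n" and B :: "real^'k^'m"
proof -
  have "(A ** B) \<bullet> C = (\<Sum>i\<in>UNIV. \<Sum>j\<in>UNIV. \<Sum>k\<in>UNIV. A $ i $ k * B $ k $ j * C $ i $ j)"
    by (simp add: matrix_matrix_mult_def inner_vec_def sum_distrib_right)
  also have "\<dots> = (\<Sum>i\<in>UNIV. \<Sum>k\<in>UNIV. \<Sum>j\<in>UNIV. A $ i $ k * B $ k $ j * C $ i $ j)"
    by (intro sum.cong refl sum.swap)
  also have "\<dots> = (\<Sum>k\<in>UNIV. \<Sum>i\<in>UNIV. \<Sum>j\<in>UNIV. A $ i $ k * B $ k $ j * C $ i $ j)"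
    by (rule sum.swap)
  also have "\<dots> = (\<Sum>k\<in>UNIV. \<Sum>j\<in>UNIV. \<Sum>i\<in>UNIV. A $ i $ k * B $ k $ j * C $ i $ j)"
    by (intro sum.cong refl sum.swap)
  also have "\<dots> = B \<bullet> (transpose A ** C)"
    by (simp add: matrix_matrix_mult_def inner_vec_def sum_distrib_left transpose_def mult_ac)
  finally show ?thesis .
qed

lemma inner_transpose: "transpose A \<bullet> transpose B = A \<bullet> B"
  for A :: "real^'m^'n"
  unfolding inner_vec_def transpose_def by (simp, rule sum.swap)

lemma inner_matrix_mult_right: "(A ** B) \<bullet> C = A \<bullet> (C ** transpose B)"
  for A :: "real^'m^'n" and B :: "real^'k^'m"
proof -
  have "(A ** B) \<bullet> C = (transpose B ** transpose A) \<bullet> transpose C"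
    by (metis inner_transpose matrix_transpose_mul)
  also have "\<dots> = transpose A \<bullet> transpose (C ** transpose B)"
    by (simp add: inner_matrix_mult_left matrix_transpose_mul)
  finally show ?thesis by (simp add: inner_transpose)
qed

lemma bounded_bilinear_matrix_matrix_mult:
  "bounded_bilinear ((**) :: real^'m^'n \<Rightarrow> real^'k^'m \<Rightarrow> real^'k^'n)"
  unfolding bilinear_conv_bounded_bilinear[symmetric] bilinear_def
  by (auto intro!: linearI simp: vec_eq_iff matrix_matrix_mult_def sum_distrib_left
      algebra_simps sum.distrib)

lemma matrix_mult_eq_0_iff:
  "A ** B = 0 \<longleftrightarrow> (\<forall>x\<in>range ((*v) B). A *v x = 0)" for A :: "real^'m^'n"
proof -
  have "A ** B = 0 \<longleftrightarrow> (\<forall>x. (A ** B) *v x = 0 *v x)"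
    using matrix_eq by blast
  then show ?thesis by (simp add: matrix_vector_mul_assoc)
qed

lemma orthogonal_projection_exists:
  fixes L :: "'a::euclidean_space set"
  assumes "subspace L"
  obtains P where "bounded_linear P" "\<And>x. P x \<in> L" "\<And>x y. y \<in> L \<Longrightarrow> (x - P x) \<bullet> y = 0"
proof -
  obtain B where B: "B \<subseteq> L" "pairwise orthogonal B" "\<And>x. x \<in> B \<Longrightarrow> norm x = 1"
    "independent B" "card B = dim L" "span B = L"
    using orthonormal_basis_subspace[OF assms] by metis
  have fin: "finite B" using B(4) by (rule finiteI_independent)
  define P where "P = (\<lambda>x. \<Sum>b\<in>B. (x \<bullet> b) *\<^sub>R b)"
  show thesis
  proof (rule that[of P])
    show "bounded_linear P" unfolding P_def
      by (intro bounded_linear_sum bounded_linear_scaleR_const bounded_linear_inner_left)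
    show "P x \<in> L" for x
      unfolding P_def by (intro subspace_sum assms subspace_scale) (use B(1) in auto)
    fix x y assume "y \<in> L"
    have "orthogonal (x - P x) b" if "b \<in> B" for b
    proof -
      have "P x \<bullet> b = (\<Sum>c\<in>B. if c = b then x \<bullet> b else 0)"
        unfolding P_def inner_sum_left
        using B(2,3) that by (intro sum.cong refl) (auto simp: pairwise_def orthogonal_def norm_eq_1)
      then show ?thesis using that fin by (simp add: orthogonal_def inner_diff_left)
    qed
    then show "(x - P x) \<bullet> y = 0"
      using orthogonal_to_span[of y B "x - P x"] \<open>y \<in> L\<close> B(6) by (simp add: orthogonal_def)
  qed
qed

lemma orth_proj_characterization:
  fixes L :: "(real^'n^'n) set"
  assumes L: "subspace L" "L \<subseteq> sym_mats"
  shows "bounded_linear (orth_proj L) \<and> (\<forall>A. orth_proj L A \<in> L) \<and>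
    (\<forall>A. \<forall>B\<in>L. (A - orth_proj L A) \<bullet> B = 0)"
proof -
  obtain P where P: "bounded_linear P" "\<And>x. P x \<in> L" "\<And>x y. y \<in> L \<Longrightarrow> (x - P x) \<bullet> y = 0"
    using orthogonal_projection_exists[OF L(1)] by metis
  have tr: "trace (A ** B) = A \<bullet> B" if "B \<in> L" for A B :: "real^'n^'n"
    using inner_matrix_trace L(2) that by blast
  have "orth_proj L A = P A" for A
    unfolding orth_proj_def
  proof (rule the_equality)
    show "P A \<in> L \<and> (\<forall>B\<in>L. trace ((A - P A) ** B) = 0)" using P by (simp add: tr)
    fix Q assume Q: "Q \<in> L \<and> (\<forall>B\<in>L. trace ((A - Q) ** B) = 0)"
    have "P A - Q \<in> L" using Q P L(1) by (simp add: subspace_diff)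
    then have "(A - Q) \<bullet> (P A - Q) = 0" "(A - P A) \<bullet> (P A - Q) = 0"
      using Q P(3) by (auto simp: tr)
    then have "(P A - Q) \<bullet> (P A - Q) = 0" by (simp add: inner_diff_left)
    then show "Q = P A" by simp
  qed
  then have "orth_proj L = P" by blast
  then show ?thesis using P by blast
qed

lemma
  fixes L :: "(real^'n^'n) set"
  assumes L: "subspace L" "L \<subseteq> sym_mats"
  shows bounded_linear_orth_proj: "bounded_linear (orth_proj L)"
    and orth_proj_in: "orth_proj L A \<in> L"
    and inner_orth_proj: "B \<in> L \<Longrightarrow> orth_proj L A \<bullet> B = A \<bullet> B"
    and orth_proj_eq_self: "A \<in> L \<Longrightarrow> orth_proj L A = A"
proof -
  have P: "bounded_linear (orth_proj L)" "\<And>A. orth_proj L A \<in> L"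
    "\<And>A B. B \<in> L \<Longrightarrow> (A - orth_proj L A) \<bullet> B = 0"
    using orth_proj_characterization[OF L] by blast+
  show "bounded_linear (orth_proj L)" "orth_proj L A \<in> L" by (fact P)+
  show "orth_proj L A \<bullet> B = A \<bullet> B" if "B \<in> L"
    using P(3)[OF that, of A] by (simp add: inner_diff_left)
  show "orth_proj L A = A" if "A \<in> L"
  proof -
    have "A - orth_proj L A \<in> L" using that P L(1) by (auto intro: subspace_diff)
    then have "(A - orth_proj L A) \<bullet> (A - orth_proj L A) = 0" by (rule P(3))
    then show ?thesis by simp
  qed
qed

section \<open>Full-dimensional subsets of a subspace\<close>

text \<open>A cell of dimension \<open>dim L\<close> inside \<open>L\<close> is open in \<open>L\<close> by invariance of domain, and no cell inside
  \<open>L\<close> has larger dimension by invariance of dimension.\<close>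

lemma semialg_dim_eq_dim_iff:
  fixes L :: "'a::euclidean_space set"
  assumes L: "subspace L" and X: "X \<subseteq> L"
  shows "semialg_dim X = int (dim L) \<longleftrightarrow> (\<exists>U. openin (top_of_set L) U \<and> U \<noteq> {} \<and> U \<subseteq> X)"
proof -
  define K where "K = {k. \<exists>(T :: 'a set) U. subspace T \<and> dim T = k \<and> U \<subseteq> X \<and> U homeomorphic (ball 0 1 \<inter> T)}"
  have cell: "\<exists>h. continuous_on (ball 0 1 \<inter> T) h \<and> inj_on h (ball 0 1 \<inter> T) \<and> h ` (ball 0 1 \<inter> T) = U"
    if "U homeomorphic (ball 0 1 \<inter> T)" for U T :: "'a set"
  proof -
    obtain g h where "homeomorphism U (ball 0 1 \<inter> T) g h"
      using \<open>U homeomorphic (ball 0 1 \<inter> T)\<close> homeomorphic_def by blast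
    then show ?thesis
      by (intro exI[of _ h]) (auto simp: homeomorphism_def intro: inj_on_inverseI[of _ g])
  qed
  have ball: "openin (top_of_set T) (ball 0 1 \<inter> T)" for T :: "'a set"
    by (subst Int_commute) (intro openin_open_Int open_ball)
  have le: "k \<le> dim L" if k: "k \<in> K" for k
  proof -
    obtain T U :: "'a set" where T: "subspace T" "dim T = k" "U \<subseteq> X" "U homeomorphic (ball 0 1 \<inter> T)"
      using k unfolding K_def by blast
    obtain h where h: "continuous_on (ball 0 1 \<inter> T) h" "inj_on h (ball 0 1 \<inter> T)" "h ` (ball 0 1 \<inter> T) = U"
      using cell[OF T(4)] by blast
    have "h \<in> (ball 0 1 \<inter> T) \<rightarrow> L" using h(3) T(3) X by blast
    moreover have "0 \<in> ball 0 1 \<inter> T" using T(1) by (simp add: subspace_0)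
    ultimately have "dim T \<le> dim L"
      using invariance_of_dimension_subspaces[OF ball T(1) L h(1) _ h(2)] by blast
    then show ?thesis using T(2) by simp
  qed
  then have fin: "finite K" using finite_nat_set_iff_bounded_le by blast
  show ?thesis
  proof
    assume dim: "semialg_dim X = int (dim L)"
    then have "X \<noteq> {}" by (auto simp: semialg_dim_def)
    then obtain x where "x \<in> X" by blast
    have "(ball 0 1 \<inter> {0 :: 'a}) = {0}" by auto
    then have "{x} homeomorphic (ball 0 1 \<inter> {0 :: 'a})"
      by (auto simp: homeomorphic_minimal)
    then have "0 \<in> K" using \<open>x \<in> X\<close> unfolding K_def
      by (intro CollectI exI[of _ "{0}"] exI[of _ "{x}"]) (auto simp: subspace_def)
    moreover have "Max K = dim L"
      using dim \<open>X \<noteq> {}\<close> unfolding semialg_dim_def K_def[symmetric] by simp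
    ultimately have "dim L \<in> K" using Max_in[OF fin] by auto
    then obtain T U :: "'a set" where T: "subspace T" "dim T = dim L" "U \<subseteq> X" "U homeomorphic (ball 0 1 \<inter> T)"
      unfolding K_def by blast
    obtain h where h: "continuous_on (ball 0 1 \<inter> T) h" "inj_on h (ball 0 1 \<inter> T)" "h ` (ball 0 1 \<inter> T) = U"
      using cell[OF T(4)] by blast
    have "h \<in> (ball 0 1 \<inter> T) \<rightarrow> L" using h(3) T(3) X by blast
    then have "openin (top_of_set L) (h ` (ball 0 1 \<inter> T))"
      using invariance_of_domain_subspaces[OF ball T(1) L _ h(1) _ h(2)] T(2) by simp
    moreover have "0 \<in> ball 0 1 \<inter> T" using T(1) by (simp add: subspace_0)
    ultimately show "\<exists>U. openin (top_of_set L) U \<and> U \<noteq> {} \<and> U \<subseteq> X"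
      using h(3) T(3) by blast
  next
    assume "\<exists>U. openin (top_of_set L) U \<and> U \<noteq> {} \<and> U \<subseteq> X"
    then obtain U u where U: "openin (top_of_set L) U" "u \<in> U" "U \<subseteq> X" by blast
    then obtain e where e: "e > 0" "ball u e \<inter> L \<subseteq> U" unfolding openin_contains_ball by blast
    have "u \<in> L" using U X by blast
    have "(\<lambda>y. u + e *\<^sub>R y) ` (ball 0 1 \<inter> L) homeomorphic (ball 0 1 \<inter> L)"
      using e(1) homeomorphic_affinity[of e "ball 0 1 \<inter> L" u] homeomorphic_sym by auto
    moreover have "(\<lambda>y. u + e *\<^sub>R y) ` (ball 0 1 \<inter> L) \<subseteq> X"
    proof -
      have "u + e *\<^sub>R y \<in> ball u e \<inter> L" if "y \<in> ball 0 1 \<inter> L" for y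
        using that e(1) L \<open>u \<in> L\<close> by (auto simp: dist_norm subspace_add subspace_scale)
      then show ?thesis using e(2) U(3) by blast
    qed
    ultimately have "dim L \<in> K" using L unfolding K_def by blast
    then have "Max K = dim L" using le fin by (intro Max_eqI) auto
    then show "semialg_dim X = int (dim L)"
      using U unfolding semialg_dim_def K_def[symmetric] by auto
  qed
qed

section \<open>Polynomial families of linear maps\<close>

lemma polynomial_function_bounded_bilinear:
  fixes h :: "'b::euclidean_space \<Rightarrow> 'c::euclidean_space \<Rightarrow> 'd::real_normed_vector"
  assumes h: "bounded_bilinear h" and f: "polynomial_function f" and g: "polynomial_function g"
  shows "polynomial_function (\<lambda>x. h (f x) (g x))"
proof -
  interpret h: bounded_bilinear h by (rule h)
  have "h (f x) (g x) = (\<Sum>i\<in>Basis. \<Sum>j\<in>Basis. ((f x \<bullet> i) * (g x \<bullet> j)) *\<^sub>R h i j)" for x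
  proof -
    have "h (f x) (g x) = h (\<Sum>i\<in>Basis. (f x \<bullet> i) *\<^sub>R i) (\<Sum>j\<in>Basis. (g x \<bullet> j) *\<^sub>R j)"
      by (simp only: euclidean_representation)
    also have "\<dots> = (\<Sum>i\<in>Basis. \<Sum>j\<in>Basis. ((f x \<bullet> i) * (g x \<bullet> j)) *\<^sub>R h i j)"
      by (simp only: h.sum_left h.sum_right h.scaleR_left h.scaleR_right scaleR_scaleR scaleR_sum_right)
         (rule trans[OF sum.swap], simp add: mult.commute)
    finally show ?thesis .
  qed
  moreover have "polynomial_function (\<lambda>x. ((f x \<bullet> i) * (g x \<bullet> j)) *\<^sub>R h i j)"
    if "i \<in> Basis" "j \<in> Basis" for i j
  proof (rule polynomial_function_mult[OF _ polynomial_function_const])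
    have "real_polynomial_function (\<lambda>x. (f x \<bullet> i) * (g x \<bullet> j))"
      using f g that
      by (intro real_polynomial_function.intros(4)) (auto simp: polynomial_function_iff_Basis_inner)
    then show "polynomial_function (\<lambda>x. (f x \<bullet> i) * (g x \<bullet> j))"
      by (simp add: real_polynomial_function_eq)
  qed
  ultimately show ?thesis by (simp add: polynomial_function_sum)
qed

lemmas polynomial_function_matrix_mult =
  polynomial_function_bounded_bilinear[OF bounded_bilinear_matrix_matrix_mult]

lemma polynomial_function_bounded_linear_image:
  assumes "bounded_linear h" "polynomial_function f"
  shows "polynomial_function (\<lambda>x. h (f x))"
  using polynomial_function_compose[OF assms(2) polynomial_function_bounded_linear[OF assms(1)]]
  by (simp add: o_def)

lemma bounded_linear_transpose: "bounded_linear (transpose :: real^'m^'n \<Rightarrow> real^'n^'m)"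
  by (intro linear_conv_bounded_linear[THEN iffD1] linearI) (auto simp: transpose_def vec_eq_iff)

lemma real_polynomial_function_det:
  assumes "\<And>i j. real_polynomial_function (\<lambda>x. M x $ i $ j)"
  shows "real_polynomial_function (\<lambda>x. det (M x :: real^'n^'n))"
  unfolding det_def using assms
  by (intro real_polynomial_function_sum real_polynomial_function.intros(4)
      real_polynomial_function.intros(2) real_polynomial_function_prod finite_permutations finite) auto

text \<open>Flattening matrices to vectors indexed by pairs turns \<open>T x\<close> into a square matrix; \<open>g x\<close> is its
  determinant.\<close>

lemma polynomial_criterion_inj:
  fixes T :: "'a::euclidean_space \<Rightarrow> real^'n^'m \<Rightarrow> real^'n^'m"
  assumes lin: "\<And>x. linear (T x)" and poly: "\<And>Y. polynomial_function (\<lambda>x. T x Y)"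
  obtains g where "real_polynomial_function g" "\<And>x. g x \<noteq> 0 \<longleftrightarrow> inj (T x)"
proof -
  define flat :: "real^'n^'m \<Rightarrow> real^('m \<times> 'n)" where "flat = (\<lambda>Y. \<chi> p. Y $ fst p $ snd p)"
  define unflat :: "real^('m \<times> 'n) \<Rightarrow> real^'n^'m" where "unflat = (\<lambda>v. \<chi> i j. v $ (i, j))"
  have inv: "unflat (flat Y) = Y" "flat (unflat v) = v" for Y v
    by (auto simp: flat_def unflat_def vec_eq_iff)
  have lins: "linear flat" "linear unflat"
    by (auto intro!: linearI simp: flat_def unflat_def vec_eq_iff)
  define S where "S = (\<lambda>x. flat \<circ> T x \<circ> unflat)"
  have linS: "linear (S x)" for x
    unfolding S_def by (intro linear_compose lins lin)
  have inj: "inj flat" "inj unflat" by (metis inv injI)+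
  have "inj (S x) \<longleftrightarrow> inj (T x)" for x
  proof
    assume "inj (S x)"
    then have "inj (unflat \<circ> S x \<circ> flat)" using inj by (auto intro!: inj_compose)
    moreover have "unflat \<circ> S x \<circ> flat = T x" by (simp add: S_def fun_eq_iff inv)
    ultimately show "inj (T x)" by simp
  next
    assume "inj (T x)"
    then show "inj (S x)" unfolding S_def using inj by (auto intro!: inj_compose)
  qed
  then have "det (matrix (S x)) \<noteq> 0 \<longleftrightarrow> inj (T x)" for x
    using det_nz_iff_inj[OF linS] by simp
  moreover have "real_polynomial_function (\<lambda>x. det (matrix (S x)))"
  proof (rule real_polynomial_function_det)
    fix i j
    have "bounded_linear (\<lambda>Y :: real^'n^'m. Y $ fst i $ snd i)"
      by (intro bounded_linear_compose[OF bounded_linear_vec_nth] bounded_linear_vec_nth)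
    from polynomial_function_bounded_linear_image[OF this poly]
    show "real_polynomial_function (\<lambda>x. matrix (S x) $ i $ j)"
      by (simp add: matrix_def S_def flat_def real_polynomial_function_eq)
  qed
  ultimately show ?thesis using that by blast
qed

section \<open>Projection matrices and orthonormal frames\<close>

lemma subspace_of_dim_between:
  fixes R :: "'a::euclidean_space set"
  assumes "subspace R" "dim R \<le> d" "d \<le> DIM('a)"
  shows "\<exists>R'. subspace R' \<and> R \<subseteq> R' \<and> dim R' = d"
  using assms
proof (induction "d - dim R" arbitrary: R)
  case 0
  then show ?case by (intro exI[of _ R]) auto
next
  case (Suc k)
  then have "dim R \<noteq> DIM('a)" by linarith
  then have "R \<noteq> UNIV" by auto
  then obtain x where x: "x \<notin> R" by blast
  then have "x \<notin> span R" using Suc.prems(1) span_eq_iff by metis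
  then have "dim (span (insert x R)) = Suc (dim R)" by (simp add: dim_insert)
  then obtain R' where "subspace R'" "span (insert x R) \<subseteq> R'" "dim R' = d"
    using Suc.hyps(1)[of "span (insert x R)"] Suc.hyps(2) Suc.prems(3) by fastforce
  then show ?case using span_superset by blast
qed

definition coord_proj :: "'n set \<Rightarrow> real^'n^'n" where
  "coord_proj I = (\<chi> i j. if i = j \<and> i \<in> I then 1 else 0)"

lemma matrix_mult_coord_proj: "(A ** coord_proj I) $ i $ j = (if j \<in> I then A $ i $ j else 0)"
  for A :: "real^'n^'m"
proof -
  have "(A ** coord_proj I) $ i $ j = (\<Sum>k\<in>UNIV. if k = j then (if j \<in> I then A $ i $ j else 0) else 0)"
    unfolding matrix_matrix_mult_def coord_proj_def vec_lambda_beta by (rule sum.cong) auto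
  then show ?thesis by simp
qed

lemma rank_coord_proj_le: "rank (coord_proj I) \<le> card I"
proof -
  have "coord_proj I *v x \<in> span ((\<lambda>i. axis i 1) ` I)" for x :: "real^'a"
  proof -
    have "(coord_proj I *v x) $ j = (\<Sum>i\<in>I. x $ i *\<^sub>R axis i (1::real)) $ j" for j
    proof -
      have "(coord_proj I *v x) $ j = (\<Sum>k\<in>UNIV. if k = j then (if j \<in> I then x $ j else 0) else 0)"
        unfolding matrix_vector_mult_def coord_proj_def vec_lambda_beta by (rule sum.cong) auto
      moreover have "(\<Sum>i\<in>I. x $ i *\<^sub>R axis i (1::real)) $ j = (\<Sum>i\<in>I. if i = j then x $ j else 0)"
        unfolding sum_component by (rule sum.cong) (auto simp: axis_def)
      ultimately show ?thesis by simp
    qed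
    then have "coord_proj I *v x = (\<Sum>i\<in>I. x $ i *\<^sub>R axis i (1::real))" by (simp add: vec_eq_iff)
    then show ?thesis by (simp only:) (intro span_sum span_scale span_base imageI)
  qed
  then have "dim (range ((*v) (coord_proj I :: real^'a^'a))) \<le> card ((\<lambda>i. axis i (1::real)) ` I)"
    by (intro dim_le_card) auto
  also have "\<dots> \<le> card I" by (intro card_image_le) simp
  finally show ?thesis by (simp add: rank_dim_range)
qed

text \<open>The columns of \<open>N\<close> with index in \<open>I\<close> are an orthonormal basis of \<open>R\<close> and the others are zero, so
  \<open>N N\<^sup>T\<close> is the orthogonal projection onto \<open>R\<close>. The index set \<open>I\<close> is prescribed so that one
  polynomial parametrization serves all subspaces of the same dimension.\<close>

lemma orthonormal_frame:
  fixes R :: "(real^'n) set" and I :: "'n set"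
  assumes R: "subspace R" and card: "card I = dim R"
  obtains N :: "real^'n^'n" where "N ** coord_proj I = N"
    "\<And>x. (N ** transpose N) *v x \<in> R" "\<And>x. x \<in> R \<Longrightarrow> (N ** transpose N) *v x = x"
proof -
  obtain B where B: "B \<subseteq> R" "pairwise orthogonal B" "\<And>x. x \<in> B \<Longrightarrow> norm x = 1"
    "independent B" "card B = dim R" "span B = R"
    using orthonormal_basis_subspace[OF R] by metis
  have fin: "finite B" using B(4) by (rule finiteI_independent)
  then obtain g where g: "bij_betw g I B"
    using finite_same_card_bij[of I B] card B(5) by auto
  define N :: "real^'n^'n" where "N = (\<chi> r i. if i \<in> I then g i $ r else 0)"
  have NN: "(N ** transpose N) *v x = (\<Sum>b\<in>B. (x \<bullet> b) *\<^sub>R b)" for x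
  proof -
    have 1: "(transpose N *v x) $ i = (if i \<in> I then x \<bullet> g i else 0)" for i
      by (simp add: matrix_vector_mult_def transpose_def N_def inner_vec_def mult.commute del: transpose_matrix_vector)
    have "(N ** transpose N) *v x = N *v (transpose N *v x)" by (simp only: matrix_vector_mul_assoc)
    also have "\<dots> = (\<Sum>i\<in>I. (x \<bullet> g i) *\<^sub>R g i)"
    proof -
      have "(N *v (transpose N *v x)) $ r = (\<Sum>i\<in>I. (x \<bullet> g i) *\<^sub>R g i) $ r" for r
      proof -
        have "(N *v (transpose N *v x)) $ r = (\<Sum>i\<in>UNIV. N $ r $ i * (transpose N *v x) $ i)"
          by (simp only: matrix_vector_mult_def vec_lambda_beta)
        also have "\<dots> = (\<Sum>i\<in>UNIV. if i \<in> I then (x \<bullet> g i) * g i $ r else 0)"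
          unfolding 1 by (auto simp: N_def intro!: sum.cong)
        also have "\<dots> = (\<Sum>i\<in>I. (x \<bullet> g i) * g i $ r)"
          by (simp add: sum.If_cases)
        finally show ?thesis by simp
      qed
      then show ?thesis by (simp add: vec_eq_iff)
    qed
    also have "\<dots> = (\<Sum>b\<in>B. (x \<bullet> b) *\<^sub>R b)"
      using sum.reindex_bij_betw[OF g, of "\<lambda>b. (x \<bullet> b) *\<^sub>R b"] by simp
    finally show ?thesis .
  qed
  show thesis
  proof (rule that[of N])
    show "N ** coord_proj I = N" by (simp add: vec_eq_iff matrix_mult_coord_proj) (simp add: N_def)
    show in_R: "(N ** transpose N) *v x \<in> R" for x
      unfolding NN using B(1) by (intro subspace_sum R subspace_scale) auto
    fix x assume x: "x \<in> R"
    let ?y = "x - (N ** transpose N) *v x"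
    have "orthogonal ?y b" if "b \<in> B" for b
    proof -
      have "((N ** transpose N) *v x) \<bullet> b = (\<Sum>c\<in>B. if c = b then x \<bullet> b else 0)"
        unfolding NN inner_sum_left using B(2,3) that
        by (intro sum.cong refl) (auto simp: pairwise_def orthogonal_def norm_eq_1)
      then show ?thesis using that fin by (simp add: orthogonal_def inner_diff_left)
    qed
    moreover have "?y \<in> span B" using x in_R R B(6) by (auto intro: subspace_diff)
    ultimately have "orthogonal ?y ?y" using orthogonal_to_span by blast
    then show "(N ** transpose N) *v x = x" by (simp add: orthogonal_self)
  qed
qed

lemma psd_mult_transpose: "psd (N ** transpose N)" for N :: "real^'n^'n"
proof -
  have "x \<bullet> ((N ** transpose N) *v x) = (transpose N *v x) \<bullet> (transpose N *v x)" for x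
    unfolding matrix_vector_mul_assoc[symmetric] dot_lmul_matrix[symmetric] by simp
  then show ?thesis
    by (simp add: psd_def sym_mats_def matrix_transpose_mul)
qed

lemma projection_matrix_exists:
  fixes R :: "(real^'n) set"
  assumes R: "subspace R"
  obtains Q :: "real^'n^'n" where "psd Q" "Q ** Q = Q" "range ((*v) Q) = R"
proof -
  have "dim R \<le> CARD('n)" using dim_subset_UNIV[of R] by simp
  then obtain I :: "'n set" where "card I = dim R"
    using obtain_subset_with_card_n by metis
  from orthonormal_frame[OF R this] obtain N :: "real^'n^'n" where
    N: "\<And>x. (N ** transpose N) *v x \<in> R" "\<And>x. x \<in> R \<Longrightarrow> (N ** transpose N) *v x = x" by metis
  show thesis
  proof (rule that[of "N ** transpose N"])
    show "psd (N ** transpose N)" by (rule psd_mult_transpose)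
    show "(N ** transpose N) ** (N ** transpose N) = N ** transpose N"
      using N by (subst matrix_eq) (simp only: matrix_vector_mul_assoc[symmetric, of "N ** transpose N"] simp_thms)
    show "range ((*v) (N ** transpose N)) = R"
    proof
      show "R \<subseteq> range ((*v) (N ** transpose N))" by (metis N(2) rangeI subsetI)
    qed (use N(1) in blast)
  qed
qed

section \<open>Generic annihilators\<close>

definition no_annihilator :: "(real^'n^'n) set \<Rightarrow> (real^'n) set \<Rightarrow> bool" where
  "no_annihilator L R \<longleftrightarrow> (\<forall>\<Omega>\<in>L. (\<forall>x\<in>R. \<Omega> *v x = 0) \<longrightarrow> \<Omega> = 0)"

lemma no_annihilator_range:
  "no_annihilator L (range ((*v) S)) \<longleftrightarrow> \<not> (\<exists>\<Omega>\<in>L. \<Omega> \<noteq> 0 \<and> \<Omega> ** S = 0)"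
  unfolding no_annihilator_def matrix_mult_eq_0_iff by blast

text \<open>The matrix \<open>Q\<close> of the projection onto \<open>R\<close> lies in the Zariski-open set where the linear
  endomorphism \<open>T S\<close> below is injective. On \<open>L\<close>, the quadratic form of \<open>T S\<close> is the squared norm of
  \<open>\<Omega> S\<close>; on the orthogonal complement of \<open>L\<close>, \<open>T S\<close> is the identity. So \<open>T S\<close> is injective exactly when \<open>\<Omega> \<mapsto> \<Omega> S\<close> is
  injective on \<open>L\<close>.\<close>

lemma generic_psd_iff_subspace:
  fixes L :: "(real^'n^'n) set"
  assumes L: "subspace L" "L \<subseteq> sym_mats"
  shows "generic_psd d (\<lambda>S. \<not> (\<exists>\<Omega>\<in>L. \<Omega> \<noteq> 0 \<and> \<Omega> ** S = 0)) \<longleftrightarrow>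
    (\<exists>R. subspace R \<and> dim R = d \<and> no_annihilator L R)"
proof
  assume "generic_psd d (\<lambda>S. \<not> (\<exists>\<Omega>\<in>L. \<Omega> \<noteq> 0 \<and> \<Omega> ** S = 0))"
  then obtain S where S: "S \<in> psd_rank d" "no_annihilator L (range ((*v) S))"
    unfolding generic_psd_def zariski_open_in_def no_annihilator_range by blast
  then have "dim (range ((*v) S)) = d" by (simp add: psd_rank_def rank_dim_range)
  moreover have "subspace (range ((*v) S))"
    by (intro linear_subspace_image) auto
  ultimately show "\<exists>R. subspace R \<and> dim R = d \<and> no_annihilator L R" using S(2) by blast
next
  assume "\<exists>R. subspace R \<and> dim R = d \<and> no_annihilator L R"
  then obtain R where R: "subspace R" "dim R = d" "no_annihilator L R" by blast
  obtain Q :: "real^'n^'n" where Q: "psd Q" "range ((*v) Q) = R"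
    using projection_matrix_exists[OF R(1)] by metis
  note P = bounded_linear_orth_proj[OF L]
  define T where "T = (\<lambda>(S :: real^'n^'n) Y. orth_proj L (orth_proj L Y ** (S ** transpose S)) + (Y - orth_proj L Y))"
  have "linear (T S)" for S
  proof -
    have "bounded_linear (T S)" unfolding T_def
      by (intro bounded_linear_add bounded_linear_sub bounded_linear_ident P
          bounded_linear_compose[OF P]
          bounded_linear_compose[OF bounded_bilinear.bounded_linear_left[OF bounded_bilinear_matrix_matrix_mult] P])
    then show ?thesis by (rule bounded_linear.linear)
  qed
  moreover have "polynomial_function (\<lambda>S. T S Y)" for Y
    unfolding T_def
    by (intro polynomial_function_add polynomial_function_const
        polynomial_function_bounded_linear_image[OF P] polynomial_function_matrix_mult
        polynomial_function_bounded_linear_image[OF bounded_linear_transpose] polynomial_function_id)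
  ultimately obtain g where g: "real_polynomial_function g" "\<And>S. g S \<noteq> 0 \<longleftrightarrow> inj (T S)"
    using polynomial_criterion_inj[of T] by metis
  have inj_T: "inj (T S) \<longleftrightarrow> no_annihilator L (range ((*v) S))" for S
  proof
    assume inj: "inj (T S)"
    show "no_annihilator L (range ((*v) S))"
      unfolding no_annihilator_range
    proof
      assume "\<exists>\<Omega>\<in>L. \<Omega> \<noteq> 0 \<and> \<Omega> ** S = 0"
      then obtain \<Omega> where \<Omega>: "\<Omega> \<in> L" "\<Omega> \<noteq> 0" "\<Omega> ** S = 0" by blast
      then have "T S \<Omega> = orth_proj L 0"
        by (simp add: T_def orth_proj_eq_self[OF L] matrix_mul_assoc)
      moreover have "T S 0 = orth_proj L 0" by (simp add: T_def linear_simps(3)[OF P])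
      ultimately show False using inj \<Omega>(2) by (metis injD)
    qed
  next
    assume no: "no_annihilator L (range ((*v) S))"
    show "inj (T S)"
    proof (subst linear_injective_0)
      show "linear (T S)" by fact
      show "\<forall>Y. T S Y = 0 \<longrightarrow> Y = 0"
      proof (intro allI impI)
        fix Y assume "T S Y = 0"
        define \<Omega> where "\<Omega> = orth_proj L Y"
        have \<Omega>: "\<Omega> \<in> L" unfolding \<Omega>_def by (rule orth_proj_in[OF L])
        have "(Y - \<Omega>) \<bullet> \<Omega> = 0"
          using inner_orth_proj[OF L \<Omega>, of Y] unfolding \<Omega>_def by (simp add: inner_diff_left)
        moreover have "orth_proj L (\<Omega> ** (S ** transpose S)) \<bullet> \<Omega> = (\<Omega> ** S) \<bullet> (\<Omega> ** S)"
          using inner_orth_proj[OF L \<Omega>] by (simp add: matrix_mul_assoc inner_matrix_mult_right)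
        ultimately have "T S Y \<bullet> \<Omega> = (\<Omega> ** S) \<bullet> (\<Omega> ** S)"
          by (simp add: T_def \<Omega>_def inner_add_left)
        then have "\<Omega> ** S = 0" using \<open>T S Y = 0\<close> by simp
        then have "\<Omega> = 0" using no \<Omega> unfolding no_annihilator_range by blast
        then show "Y = 0" using \<open>T S Y = 0\<close> by (simp add: T_def \<Omega>_def linear_simps(3)[OF P])
      qed
    qed
  qed
  define U where "U = psd_rank d - {S. \<forall>p\<in>{g}. p S = 0}"
  have "zariski_open_in (psd_rank d) U"
    unfolding zariski_open_in_def U_def using g(1) by (intro exI[of _ "{g}"]) auto
  moreover have "Q \<in> U"
    using Q R by (auto simp: U_def psd_rank_def rank_dim_range g(2) inj_T)
  moreover have "\<not> (\<exists>\<Omega>\<in>L. \<Omega> \<noteq> 0 \<and> \<Omega> ** S = 0)" if "S \<in> U" for S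
    using that g(2) inj_T no_annihilator_range unfolding U_def by blast
  ultimately show "generic_psd d (\<lambda>S. \<not> (\<exists>\<Omega>\<in>L. \<Omega> \<noteq> 0 \<and> \<Omega> ** S = 0))"
    unfolding generic_psd_def by blast
qed

section \<open>Fullness of the projection of the rank locus\<close>

lemma rank_congruence:
  fixes A Q :: "real^'n^'n"
  assumes "invertible A"
  shows "rank (A ** Q ** transpose A) = rank Q"
proof -
  have left: "rank (B ** C) = rank C" if B: "invertible B" for B C :: "real^'n^'n"
  proof -
    obtain B' where "B' ** B = mat 1" using B unfolding invertible_def by blast
    then have "B' ** (B ** C) = C" by (simp add: matrix_mul_assoc)
    then show ?thesis using rank_mul_le_right[of B C] rank_mul_le_right[of B' "B ** C"] by simp
  qed
  have "rank (A ** Q ** transpose A) = rank (A ** transpose Q)"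
    using left[OF assms] rank_transpose[of "A ** Q ** transpose A"]
    by (metis left[OF assms] matrix_transpose_mul rank_transpose transpose_transpose matrix_mul_assoc)
  then show ?thesis using left[OF assms] by (simp add: rank_transpose)
qed

text \<open>Every symmetric matrix of rank \<open>d\<close> has the form \<open>N C N\<^sup>T\<close> where only the columns of \<open>N\<close> with index
  in a fixed \<open>d\<close>-element set \<open>I\<close> are nonzero. So \<open>(A, C) \<mapsto> N C N\<^sup>T\<close>, \<open>N = A E\<close> with \<open>E = coord_proj I\<close>,
  is a polynomial map whose image covers the rank locus, and adding \<open>Y - orth_proj L Y\<close> fills the orthogonal
  complement of \<open>L\<close>, so that the target is the full matrix space. Where the derivative is onto, no
  nonzero \<open>\<Omega> \<in> L\<close> satisfies \<open>\<Omega> N = 0\<close>, as it would be orthogonal to the range of the derivative. The range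
  of \<open>N\<close> may have dimension smaller than \<open>d\<close>, but any \<open>d\<close>-dimensional
  subspace containing it serves as \<open>R\<close>.\<close>

lemma projection_interior_imp_subspace:
  fixes L :: "(real^'n^'n) set"
  assumes L: "subspace L" "L \<subseteq> sym_mats"
    and U: "openin (top_of_set L) U" "U \<noteq> {}" "U \<subseteq> orth_proj L ` sym_rank d"
  shows "\<exists>R. subspace R \<and> dim R = d \<and> no_annihilator L R"
proof -
  let ?P = "orth_proj L"
  note blP = bounded_linear_orth_proj[OF L]
  obtain u where u: "u \<in> U" using U(2) by blast
  then obtain S0 :: "real^'n^'n" where "S0 \<in> sym_rank d" using U(3) by blast
  then have d: "d \<le> CARD('n)" using rank_bound[of S0] by (simp add: sym_rank_def)
  then obtain I :: "'n set" where I: "card I = d" using obtain_subset_with_card_n by metis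
  let ?E = "coord_proj I"
  define F :: "(real^'n^'n) \<times> (real^'n^'n) \<times> (real^'n^'n) \<Rightarrow> real^'n^'n" where
    "F = (\<lambda>p. ?P ((fst p ** ?E) ** fst (snd p) ** transpose (fst p ** ?E)) + (snd (snd p) - ?P (snd (snd p))))"
  have bl: "bounded_linear (\<lambda>p :: (real^'n^'n) \<times> (real^'n^'n) \<times> (real^'n^'n). fst p ** ?E)"
    "bounded_linear (\<lambda>p :: (real^'n^'n) \<times> (real^'n^'n) \<times> (real^'n^'n). fst (snd p))"
    "bounded_linear (\<lambda>p :: (real^'n^'n) \<times> (real^'n^'n) \<times> (real^'n^'n). snd (snd p))"
    by (intro bounded_linear_compose[OF bounded_linear_fst] bounded_linear_compose[OF bounded_linear_snd]
        bounded_linear_compose[OF bounded_bilinear.bounded_linear_left[OF bounded_bilinear_matrix_matrix_mult]]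
        bounded_linear_fst bounded_linear_snd)+
  have poly_u: "polynomial_function (\<lambda>p :: (real^'n^'n) \<times> (real^'n^'n) \<times> (real^'n^'n). (fst p ** ?E) ** fst (snd p))"
    by (intro polynomial_function_matrix_mult polynomial_function_bounded_linear bl)
  have "polynomial_function F"
    unfolding F_def
    by (intro polynomial_function_add polynomial_function_diff polynomial_function_matrix_mult[OF poly_u]
        polynomial_function_bounded_linear_image[OF blP]
        polynomial_function_bounded_linear_image[OF bounded_linear_transpose]
        polynomial_function_bounded_linear bl)
  moreover have "interior (range F) \<noteq> {}"
  proof -
    obtain V where V: "open V" "U = L \<inter> V" using U(1) by (auto simp: openin_open)
    have "open (?P -` V)"
      using blP V(1) by (intro open_vimage) (simp_all add: linear_continuous_on)
    moreover have "?P -` V \<subseteq> range F"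
    proof
      fix Z assume "Z \<in> ?P -` V"
      then have "?P Z \<in> U" using V(2) orth_proj_in[OF L] by simp
      then obtain S where S: "S \<in> sym_rank d" "?P Z = ?P S" using U(3) by blast
      have dim: "card I = dim (range ((*v) S))"
        using S(1) I by (simp add: sym_rank_def rank_dim_range)
      have "subspace (range ((*v) S))" by (intro linear_subspace_image) auto
      then obtain N :: "real^'n^'n" where N: "N ** ?E = N"
        "\<And>x. x \<in> range ((*v) S) \<Longrightarrow> (N ** transpose N) *v x = x"
        using orthonormal_frame[OF _ dim] by metis
      have QS: "(N ** transpose N) ** S = S"
        by (subst matrix_eq) (simp only: matrix_vector_mul_assoc[symmetric, of _ S] N(2) rangeI simp_thms)
      have "transpose S = S" using S(1) by (simp add: sym_rank_def sym_mats_def)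
      then have SQ: "S ** (N ** transpose N) = S"
        using arg_cong[OF QS, of transpose] by (simp add: matrix_transpose_mul)
      \<comment> \<open>The middle factor is \<open>S\<close> written in the frame \<open>N\<close>; conjugating back recovers \<open>S\<close> because \<open>N N\<^sup>T\<close>
        fixes the range of \<open>S\<close>.\<close>
      have "N ** (transpose N ** S ** N) ** transpose N = ((N ** transpose N) ** S) ** (N ** transpose N)"
        by (simp only: matrix_mul_assoc)
      then have "N ** (transpose N ** S ** N) ** transpose N = S" by (simp only: QS SQ)
      then have "F (N, transpose N ** S ** N, Z) = Z"
        by (simp add: F_def N(1) S(2))
      then show "Z \<in> range F" by (metis rangeI)
    qed
    moreover have "u \<in> ?P -` V"
      using u V(2) orth_proj_eq_self[OF L] by simp
    ultimately show ?thesis using interior_maximal by blast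
  qed
  ultimately obtain p F' where F': "(F has_derivative F') (at p)" "surj F'"
    using polynomial_image_interior_imp_surj_derivative by blast
  let ?N = "fst p ** ?E"
  have no: "\<Omega> = 0" if \<Omega>: "\<Omega> \<in> L" "\<Omega> ** ?N = 0" for \<Omega>
  proof -
    have sym: "transpose \<Omega> = \<Omega>" using \<Omega>(1) L(2) by (auto simp: sym_mats_def)
    have F_inner: "F q \<bullet> \<Omega> = ((fst q ** ?E) ** fst (snd q)) \<bullet> (\<Omega> ** (fst q ** ?E))" for q
      using inner_orth_proj[OF L \<Omega>(1)]
      by (simp add: F_def inner_add_left inner_diff_left inner_matrix_mult_right[of _ "transpose (fst q ** ?E)"])
    obtain u' where u': "((\<lambda>q :: (real^'n^'n) \<times> (real^'n^'n) \<times> (real^'n^'n). (fst q ** ?E) ** fst (snd q)) has_derivative u') (at p)"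
      using differentiable_at_polynomial_function[OF poly_u] unfolding differentiable_def by blast
    have w': "((\<lambda>q :: (real^'n^'n) \<times> (real^'n^'n) \<times> (real^'n^'n). \<Omega> ** (fst q ** ?E)) has_derivative (\<lambda>q. \<Omega> ** (fst q ** ?E))) (at p)"
      by (intro bounded_linear_imp_has_derivative bl
          bounded_linear_compose[OF bounded_bilinear.bounded_linear_right[OF bounded_bilinear_matrix_matrix_mult]])
    have "((\<lambda>q. F q \<bullet> \<Omega>) has_derivative
        (\<lambda>v. (?N ** fst (snd p)) \<bullet> (\<Omega> ** (fst v ** ?E)) + u' v \<bullet> (\<Omega> ** ?N))) (at p)"
      unfolding F_inner using u' w' by (rule has_derivative_inner)
    moreover have "(?N ** fst (snd p)) \<bullet> (\<Omega> ** (fst v ** ?E)) = 0" for v :: "(real^'n^'n) \<times> (real^'n^'n) \<times> (real^'n^'n)"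
    proof -
      have "(?N ** fst (snd p)) \<bullet> (\<Omega> ** (fst v ** ?E)) = (transpose \<Omega> ** (?N ** fst (snd p))) \<bullet> (fst v ** ?E)"
        by (metis inner_commute inner_matrix_mult_left)
      also have "transpose \<Omega> ** (?N ** fst (snd p)) = (\<Omega> ** ?N) ** fst (snd p)"
        by (simp add: sym matrix_mul_assoc)
      finally show ?thesis by (simp add: \<Omega>(2))
    qed
    ultimately have "((\<lambda>q. F q \<bullet> \<Omega>) has_derivative (\<lambda>v. 0)) (at p)"
      by (simp add: \<Omega>(2))
    moreover have "((\<lambda>q. F q \<bullet> \<Omega>) has_derivative (\<lambda>v. F' v \<bullet> \<Omega>)) (at p)"
      using F'(1) by (rule has_derivative_inner_left)
    ultimately have "(\<lambda>v. F' v \<bullet> \<Omega>) = (\<lambda>v. 0)" by (rule has_derivative_unique[rotated])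
    moreover obtain v where "\<Omega> = F' v" using F'(2) by blast
    ultimately have "\<Omega> \<bullet> \<Omega> = 0" by metis
    then show ?thesis by simp
  qed
  have sub: "subspace (range ((*v) ?N))" by (intro linear_subspace_image) auto
  have "dim (range ((*v) ?N)) \<le> d"
    using rank_mul_le_right[of "fst p" ?E] rank_coord_proj_le[of I] I by (simp add: rank_dim_range)
  then obtain R where R: "subspace R" "range ((*v) ?N) \<subseteq> R" "dim R = d"
    using subspace_of_dim_between[OF sub, of d] d by auto
  have "no_annihilator L R"
    unfolding no_annihilator_def
  proof (intro ballI impI)
    fix \<Omega> assume "\<Omega> \<in> L" "\<forall>x\<in>R. \<Omega> *v x = 0"
    then show "\<Omega> = 0" using no R(2) matrix_mult_eq_0_iff by blast
  qed
  then show ?thesis using R by blast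
qed

text \<open>The locus is parametrized near the projection \<open>Q\<close> onto \<open>R\<close> by congruence, \<open>A \<mapsto> A Q A\<^sup>T\<close> with
  \<open>A\<close> invertible, and the orthogonal complement of \<open>L\<close> is again filled by \<open>Y - orth_proj L Y\<close>. If \<open>\<Omega>\<close>
  is orthogonal to the range of the derivative at the identity, the second summand forces \<open>\<Omega> \<in> L\<close>, and the
  direction \<open>\<Omega> Q\<close> in the first summand gives \<open>2 \<parallel>\<Omega> Q\<parallel>\<^sup>2 = 0\<close>.\<close>

lemma subspace_imp_projection_interior:
  fixes L :: "(real^'n^'n) set"
  assumes L: "subspace L" "L \<subseteq> sym_mats"
    and R: "subspace R" "dim R = d" "no_annihilator L R"
  shows "\<exists>U. openin (top_of_set L) U \<and> U \<noteq> {} \<and> U \<subseteq> orth_proj L ` sym_rank d"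
proof -
  let ?P = "orth_proj L"
  note blP = bounded_linear_orth_proj[OF L]
  interpret P: bounded_linear ?P by (rule blP)
  obtain Q :: "real^'n^'n" where Q: "psd Q" "Q ** Q = Q" "range ((*v) Q) = R"
    using projection_matrix_exists[OF R(1)] by metis
  have symQ: "transpose Q = Q" using Q(1) by (simp add: psd_def sym_mats_def)
  define F :: "(real^'n^'n) \<times> (real^'n^'n) \<Rightarrow> real^'n^'n" where
    "F = (\<lambda>p. ?P (fst p ** Q ** transpose (fst p)) + (snd p - ?P (snd p)))"
  define F' :: "(real^'n^'n) \<times> (real^'n^'n) \<Rightarrow> real^'n^'n" where
    "F' = (\<lambda>v. ?P (Q ** transpose (fst v) + fst v ** Q) + (snd v - ?P (snd v)))"
  have bl: "bounded_linear (\<lambda>p :: (real^'n^'n) \<times> (real^'n^'n). fst p ** Q)"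
    "bounded_linear (\<lambda>p :: (real^'n^'n) \<times> (real^'n^'n). transpose (fst p))"
    by (intro bounded_linear_compose[OF bounded_linear_transpose]
        bounded_linear_compose[OF bounded_bilinear.bounded_linear_left[OF bounded_bilinear_matrix_matrix_mult]]
        bounded_linear_fst)+
  have polyF: "polynomial_function F"
    unfolding F_def
    by (intro polynomial_function_add polynomial_function_diff polynomial_function_matrix_mult
        polynomial_function_bounded_linear_image[OF blP] polynomial_function_bounded_linear bl
        bounded_linear_snd)
  have derF: "(F has_derivative F') (at (mat 1, 0))"
  proof -
    have "((\<lambda>p :: (real^'n^'n) \<times> (real^'n^'n). (fst p ** Q) ** transpose (fst p)) has_derivative
        (\<lambda>v. (fst (mat 1 :: real^'n^'n, 0 :: real^'n^'n) ** Q) ** transpose (fst v) +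
             (fst v ** Q) ** transpose (fst (mat 1 :: real^'n^'n, 0 :: real^'n^'n)))) (at (mat 1, 0))"
      by (intro bounded_bilinear.FDERIV[OF bounded_bilinear_matrix_matrix_mult]
          bounded_linear_imp_has_derivative bl)
    then have "((\<lambda>p :: (real^'n^'n) \<times> (real^'n^'n). (fst p ** Q) ** transpose (fst p)) has_derivative
        (\<lambda>v. Q ** transpose (fst v) + fst v ** Q)) (at (mat 1, 0))"
      by (simp add: transpose_mat)
    then show ?thesis
      unfolding F_def F'_def
      by (intro has_derivative_add has_derivative_diff P.has_derivative
          bounded_linear_imp_has_derivative bounded_linear_snd)
  qed
  have blF': "bounded_linear F'" using derF by (rule has_derivative_bounded_linear)
  then have linF': "linear F'" by (rule bounded_linear.linear)
  have "surj F'"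
  proof (rule ccontr)
    assume "\<not> surj F'"
    moreover have "subspace (range F')" using linF' by (intro linear_subspace_image) auto
    ultimately have "dim (range F') \<noteq> DIM(real^'n^'n)"
      by (metis dim_eq_full span_eq_iff)
    then have "dim (range F') < DIM(real^'n^'n)"
      using dim_subset_UNIV[of "range F'"] by simp
    then obtain \<Omega> where \<Omega>: "\<Omega> \<noteq> 0" and orth: "\<And>y. y \<in> span (range F') \<Longrightarrow> orthogonal \<Omega> y"
      using orthogonal_to_subspace_exists by blast
    have zero: "\<Omega> \<bullet> F' v = 0" for v
      using orth[of "F' v"] by (auto simp: orthogonal_def intro: span_base)
    have "\<Omega> \<bullet> (\<Omega> - ?P \<Omega>) = 0"
      using zero[of "(0, \<Omega>)"] by (simp add: F'_def transpose_def P.zero vec_eq_iff flip: zero_vec_def)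
    moreover have "?P \<Omega> \<bullet> (\<Omega> - ?P \<Omega>) = 0"
      using inner_orth_proj[OF L orth_proj_in[OF L], of \<Omega> \<Omega>]
      by (simp add: inner_diff_right inner_commute)
    ultimately have "(\<Omega> - ?P \<Omega>) \<bullet> (\<Omega> - ?P \<Omega>) = 0" by (simp add: inner_diff_left)
    then have "\<Omega> = ?P \<Omega>" by simp
    then have \<Omega>L: "\<Omega> \<in> L" using orth_proj_in[OF L] by metis
    then have sym: "transpose \<Omega> = \<Omega>" using L(2) by (auto simp: sym_mats_def)
    have "F' (\<Omega> ** Q, 0) \<bullet> \<Omega> = (Q ** transpose (\<Omega> ** Q) + \<Omega> ** Q ** Q) \<bullet> \<Omega>"
      using inner_orth_proj[OF L \<Omega>L] by (simp add: F'_def P.zero)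
    also have "\<dots> = (Q ** \<Omega>) \<bullet> \<Omega> + (\<Omega> ** Q) \<bullet> \<Omega>"
    proof -
      have "Q ** transpose (\<Omega> ** Q) = Q ** \<Omega>"
        by (simp add: matrix_transpose_mul sym symQ matrix_mul_assoc Q(2))
      moreover have "\<Omega> ** Q ** Q = \<Omega> ** Q" by (simp add: matrix_mul_assoc[symmetric] Q(2))
      ultimately show ?thesis by (simp add: inner_add_left)
    qed
    also have "(Q ** \<Omega>) \<bullet> \<Omega> = (\<Omega> ** Q) \<bullet> \<Omega>"
      using inner_transpose[of "Q ** \<Omega>" \<Omega>] by (simp add: matrix_transpose_mul sym symQ)
    also have "(\<Omega> ** Q) \<bullet> \<Omega> = (\<Omega> ** Q) \<bullet> (\<Omega> ** Q)"
    proof -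
      have "(\<Omega> ** Q) \<bullet> \<Omega> = ((\<Omega> ** Q) ** Q) \<bullet> \<Omega>" by (simp add: matrix_mul_assoc[symmetric] Q(2))
      also have "\<dots> = (\<Omega> ** Q) \<bullet> (\<Omega> ** transpose Q)" by (rule inner_matrix_mult_right)
      finally show ?thesis by (simp add: symQ)
    qed
    finally have "(\<Omega> ** Q) \<bullet> (\<Omega> ** Q) = 0"
      using zero[of "(\<Omega> ** Q, 0)"] by (simp add: inner_commute)
    then have "\<Omega> ** Q = 0" by simp
    then show False
      using R(3) \<Omega> \<Omega>L unfolding Q(3)[symmetric] no_annihilator_range by blast
  qed
  then obtain G' where G': "linear G'" "F' \<circ> G' = id"
    using linear_surjective_right_inverse[OF linF'] by blast
  define S :: "((real^'n^'n) \<times> (real^'n^'n)) set" where "S = {p. det (fst p) \<noteq> 0}"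
  have "open S"
  proof -
    have "real_polynomial_function (\<lambda>p :: (real^'n^'n) \<times> (real^'n^'n). det (fst p))"
    proof (rule real_polynomial_function_det)
      show "real_polynomial_function (\<lambda>p :: (real^'n^'n) \<times> (real^'n^'n). fst p $ i $ j)" for i j
        by (intro real_polynomial_function.intros(1) bounded_linear_compose[OF bounded_linear_vec_nth]
            bounded_linear_fst)
    qed
    then have "continuous_on UNIV (\<lambda>p :: (real^'n^'n) \<times> (real^'n^'n). det (fst p))"
      by (intro continuous_on_polymonial_function) (simp add: real_polynomial_function_eq)
    then show ?thesis unfolding S_def by (intro open_Collect_neq continuous_on_const)
  qed
  have "F (mat 1, 0) \<in> interior (F ` S)"
  proof (rule sussmann_open_mapping[OF \<open>open S\<close> _ _ derF _ G'(2)])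
    show "continuous_on S F" using polyF by (rule continuous_on_polymonial_function)
    show "(mat 1, 0) \<in> S" "(mat 1, 0) \<in> interior S"
      using \<open>open S\<close> by (auto simp: interior_open S_def)
    show "bounded_linear G'" using G'(1) by (simp add: linear_conv_bounded_linear)
  qed auto
  moreover have "F (mat 1, 0) \<in> L"
    using orth_proj_in[OF L] by (simp add: F_def P.zero)
  moreover have "L \<inter> interior (F ` S) \<subseteq> ?P ` sym_rank d"
  proof
    fix z assume z: "z \<in> L \<inter> interior (F ` S)"
    then obtain A Y where AY: "z = F (A, Y)" "det A \<noteq> 0"
      using interior_subset by (fastforce simp: S_def)
    have "z = ?P z" using z orth_proj_eq_self[OF L] by simp
    also have "\<dots> = ?P (A ** Q ** transpose A)"
      using orth_proj_eq_self[OF L orth_proj_in[OF L]] by (simp add: AY F_def P.add P.diff)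
    finally have "z = ?P (A ** Q ** transpose A)" .
    moreover have "A ** Q ** transpose A \<in> sym_rank d"
    proof -
      have "rank Q = d" using Q(3) R(2) by (simp add: rank_dim_range)
      then show ?thesis
        using AY(2) by (simp add: sym_rank_def sym_mats_def rank_congruence invertible_det_nz
            matrix_transpose_mul symQ matrix_mul_assoc)
    qed
    ultimately show "z \<in> ?P ` sym_rank d" by blast
  qed
  ultimately show ?thesis
    by (intro exI[of _ "L \<inter> interior (F ` S)"]) (auto intro: openin_open_Int)
qed

lemma projection_full_dimensional_iff_generic:
  fixes L :: "(real^'n^'n) set"
  assumes L: "subspace L" "L \<subseteq> sym_mats"
  shows "semialg_dim (orth_proj L ` sym_rank d) = int (dim L) \<longleftrightarrow>
    generic_psd d (\<lambda>S. \<not> (\<exists>\<Omega>\<in>L. \<Omega> \<noteq> 0 \<and> \<Omega> ** S = 0))"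
proof -
  have sub: "orth_proj L ` sym_rank d \<subseteq> L" using orth_proj_in[OF L] by blast
  show ?thesis
    unfolding semialg_dim_eq_dim_iff[OF L(1) sub] generic_psd_iff_subspace[OF L]
  proof (intro iffI; elim exE conjE)
    fix U assume "openin (top_of_set L) U" "U \<noteq> {}" "U \<subseteq> orth_proj L ` sym_rank d"
    then show "\<exists>R. subspace R \<and> dim R = d \<and> no_annihilator L R"
      by (rule projection_interior_imp_subspace[OF L])
  next
    fix R assume "subspace R" "dim R = d" "no_annihilator L R"
    then show "\<exists>U. openin (top_of_set L) U \<and> U \<noteq> {} \<and> U \<subseteq> orth_proj L ` sym_rank d"
      by (rule subspace_imp_projection_interior[OF L])
  qed
qed

section \<open>Positive semidefinite matrices\<close>

text \<open>The discriminant of the nonnegative quadratic polynomial \<open>t \<mapsto> (x + t y) \<bullet> A (x + t y)\<close>.\<close>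

lemma psd_cauchy_schwarz:
  assumes "psd A"
  shows "(x \<bullet> (A *v y))\<^sup>2 \<le> (x \<bullet> (A *v x)) * (y \<bullet> (A *v y))"
proof -
  have sym: "y \<bullet> (A *v x) = x \<bullet> (A *v y)"
    using assms dot_lmul_matrix[of y A x] transpose_matrix_vector[of A y]
    by (simp add: psd_def sym_mats_def inner_commute)
  let ?a = "x \<bullet> (A *v x)" and ?b = "x \<bullet> (A *v y)" and ?c = "y \<bullet> (A *v y)"
  have nonneg: "z \<bullet> (A *v z) \<ge> 0" for z using assms by (simp add: psd_def)
  have quad: "0 \<le> ?a + 2 * t * ?b + t\<^sup>2 * ?c" for t
  proof -
    have "0 \<le> (x + t *\<^sub>R y) \<bullet> (A *v (x + t *\<^sub>R y))" by (rule nonneg)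
    also have "\<dots> = ?a + t * ?b + t * (y \<bullet> (A *v x)) + t * t * ?c"
      by (simp add: matrix_vector_right_distrib matrix_vector_mult_scaleR inner_add_left inner_add_right algebra_simps)
    finally show ?thesis by (simp add: sym power2_eq_square algebra_simps)
  qed
  show ?thesis
  proof (cases "?c = 0")
    case True
    have "?b = 0"
    proof (rule ccontr)
      assume "?b \<noteq> 0"
      then show False using quad[of "- (?a + 1) / (2 * ?b)"] True by (simp add: field_simps)
    qed
    then show ?thesis using True by simp
  next
    case False
    then have "?c > 0" using nonneg[of y] by simp
    then show ?thesis using quad[of "- ?b / ?c"]
      by (simp add: field_simps power2_eq_square)
  qed
qed

lemma psd_quadratic_form_zero:
  assumes "psd A" "x \<bullet> (A *v x) = 0" shows "A *v x = 0"
  using psd_cauchy_schwarz[OF assms(1), of "A *v x" x] assms(2) by simp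

definition outer :: "real^'n \<Rightarrow> real^'n^'n" where
  "outer w = (\<chi> i j. w $ i * w $ j)"

lemma outer_mult_vec: "outer w *v x = (w \<bullet> x) *\<^sub>R w"
  by (simp add: outer_def matrix_vector_mult_def vec_eq_iff inner_vec_def sum_distrib_left sum_distrib_right mult_ac)

lemma trace_outer_mult: "trace (outer w ** K) = w \<bullet> (K *v w)"
  by (simp add: outer_def trace_def matrix_matrix_mult_def matrix_vector_mult_def inner_vec_def
      sum_distrib_left) (subst sum.swap, simp add: mult_ac)

text \<open>A Cholesky step: if \<open>x \<bullet> S x > 0\<close>, subtracting the outer square of \<open>w = S x / sqrt (x \<bullet> S x)\<close>
  leaves a positive semidefinite matrix, by the Cauchy-Schwarz inequality, and enlarges the kernel by \<open>x\<close>.\<close>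

lemma psd_sum_outer:
  assumes "psd (S :: real^'n^'n)"
  shows "\<exists>ws. S = (\<Sum>w\<leftarrow>ws. outer w)"
  using assms
proof (induction "CARD('n) - dim {y. S *v y = 0}" arbitrary: S rule: less_induct)
  case less
  show ?case
  proof (cases "S = 0")
    case True
    then show ?thesis by (intro exI[of _ "[]"]) simp
  next
    case False
    then obtain x where "S *v x \<noteq> 0" by (metis matrix_eq matrix_vector_mult_0)
    then have "x \<bullet> (S *v x) \<noteq> 0" using psd_quadratic_form_zero[OF less.prems] by blast
    then have pos: "x \<bullet> (S *v x) > 0" using less.prems unfolding psd_def by (metis order_le_less)
    let ?a = "x \<bullet> (S *v x)"
    define w where "w = (1 / sqrt ?a) *\<^sub>R (S *v x)"
    have w_inner: "(w \<bullet> y)\<^sup>2 * ?a = (x \<bullet> (S *v y))\<^sup>2" for y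
    proof -
      have "(S *v x) \<bullet> y = x \<bullet> (S *v y)"
        using less.prems dot_lmul_matrix[of x S y] transpose_matrix_vector[of S x]
        by (simp add: psd_def sym_mats_def)
      then show ?thesis using pos by (simp add: w_def power_divide)
    qed
    define S' where "S' = S - outer w"
    have S': "S' *v y = S *v y - (w \<bullet> y) *\<^sub>R w" for y
      by (simp add: S'_def matrix_vector_mult_diff_rdistrib outer_mult_vec)
    have "psd S'"
    proof -
      have "transpose S' = S'"
        using less.prems by (simp add: psd_def sym_mats_def S'_def outer_def transpose_def vec_eq_iff mult.commute)
      moreover have "y \<bullet> (S' *v y) \<ge> 0" for y
      proof -
        have "(w \<bullet> y)\<^sup>2 * ?a \<le> ?a * (y \<bullet> (S *v y))"
          unfolding w_inner by (rule psd_cauchy_schwarz[OF less.prems])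
        then have "(w \<bullet> y)\<^sup>2 \<le> y \<bullet> (S *v y)" using pos by (simp add: mult.commute)
        then show ?thesis by (simp add: S' inner_diff_right power2_eq_square inner_commute)
      qed
      ultimately show ?thesis by (simp add: psd_def sym_mats_def)
    qed
    moreover have "CARD('n) - dim {y. S' *v y = 0} < CARD('n) - dim {y. S *v y = 0}"
    proof -
      have sub: "{y. S *v y = 0} \<subseteq> {y. S' *v y = 0}"
      proof
        fix y assume "y \<in> {y. S *v y = 0}"
        then have "S *v y = 0" by simp
        moreover from this have "w \<bullet> y = 0" using w_inner[of y] pos by simp
        ultimately show "y \<in> {y. S' *v y = 0}" by (simp add: S')
      qed
      have "S' *v x = 0"
      proof -
        have "x \<bullet> (S' *v x) = 0"
          using w_inner[of x] pos by (simp add: S' inner_diff_right power2_eq_square inner_commute)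
        then show ?thesis by (rule psd_quadratic_form_zero[OF \<open>psd S'\<close>])
      qed
      then have psub: "{y. S *v y = 0} \<subset> {y. S' *v y = 0}"
        using sub \<open>S *v x \<noteq> 0\<close> by blast
      have subsp: "subspace {y. M *v y = 0}" for M :: "real^'n^'n"
        by (auto simp: subspace_def matrix_vector_right_distrib matrix_vector_mult_scaleR)
      have "span {y. S *v y = 0} \<subset> span {y. S' *v y = 0}"
        using psub subsp by (metis span_eq_iff)
      then have "dim {y. S *v y = 0} < dim {y. S' *v y = 0}" by (rule dim_psubset)
      moreover have "dim {y. S' *v y = 0} \<le> CARD('n)"
        using dim_subset_UNIV[of "{y. S' *v y = 0}"] by simp
      ultimately show ?thesis by linarith
    qed
    ultimately obtain ws where "S' = (\<Sum>w\<leftarrow>ws. outer w)" using less.hyps by blast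
    then show ?thesis by (intro exI[of _ "w # ws"]) (simp add: S'_def diff_eq_eq add.commute)
  qed
qed

lemma trace_mult_psd:
  assumes "psd S" "psd K"
  shows "trace (S ** K) \<ge> 0" and "trace (S ** K) = 0 \<Longrightarrow> K ** S = 0"
proof -
  obtain ws where S: "S = (\<Sum>w\<leftarrow>ws. outer w)" using psd_sum_outer[OF assms(1)] by blast
  have tr: "trace (S ** K) = (\<Sum>w\<leftarrow>ws. w \<bullet> (K *v w))"
    unfolding S by (induction ws)
      (auto simp: bounded_bilinear.add_left[OF bounded_bilinear_matrix_matrix_mult] trace_add
        trace_outer_mult trace_def[of "0 :: real^'a^'a"])
  have nonneg: "w \<bullet> (K *v w) \<ge> 0" for w using assms(2) by (simp add: psd_def)
  show "trace (S ** K) \<ge> 0" unfolding tr by (intro sum_list_nonneg) (use nonneg in auto)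
  assume "trace (S ** K) = 0"
  then have "\<forall>w\<in>set ws. w \<bullet> (K *v w) = 0"
    using sum_list_nonneg_eq_0_iff[of "map (\<lambda>w. w \<bullet> (K *v w)) ws"] nonneg unfolding tr by auto
  then have K: "\<forall>w\<in>set ws. K *v w = 0" using psd_quadratic_form_zero[OF assms(2)] by blast
  have "K *v (S *v x) = 0" for x
    unfolding S using K
    by (induction ws) (auto simp: matrix_vector_mult_add_rdistrib matrix_vector_right_distrib
        outer_mult_vec matrix_vector_mult_scaleR)
  then show "K ** S = 0" unfolding matrix_mult_eq_0_iff by blast
qed

section \<open>Existence of the maximum likelihood estimate\<close>

lemma pos_def_iff: "pos_def A \<longleftrightarrow> psd A \<and> det A \<noteq> 0"
proof
  assume A: "pos_def A"
  then have "psd A" unfolding psd_def pos_def_def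
    by (metis inner_zero_left order_less_imp_le order_refl)
  moreover have "x = 0" if "A *v x = 0" for x
  proof (rule ccontr)
    assume "x \<noteq> 0"
    then have "x \<bullet> (A *v x) > 0" using A by (simp add: pos_def_def)
    then show False using that by simp
  qed
  then have "invertible A"
    by (simp add: invertible_left_inverse matrix_left_invertible_ker)
  ultimately show "psd A \<and> det A \<noteq> 0" by (simp add: invertible_det_nz)
next
  assume A: "psd A \<and> det A \<noteq> 0"
  then have ker: "\<And>x. A *v x = 0 \<Longrightarrow> x = 0"
    by (metis invertible_det_nz invertible_left_inverse matrix_left_invertible_ker)
  have "x \<bullet> (A *v x) > 0" if "x \<noteq> 0" for x
  proof -
    have "x \<bullet> (A *v x) \<noteq> 0" using psd_quadratic_form_zero[of A x] A ker that by blast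
    moreover have "x \<bullet> (A *v x) \<ge> 0" using A by (simp add: psd_def)
    ultimately show ?thesis by simp
  qed
  then show "pos_def A" using A by (simp add: pos_def_def psd_def)
qed

lemma continuous_on_det: "continuous_on X (det :: real^'n^'n \<Rightarrow> real)"
proof -
  have "real_polynomial_function (\<lambda>A :: real^'n^'n. det A)"
  proof (rule real_polynomial_function_det)
    show "real_polynomial_function (\<lambda>A :: real^'n^'n. A $ i $ j)" for i j
      by (intro real_polynomial_function.intros(1) bounded_linear_compose[OF bounded_linear_vec_nth]
          bounded_linear_vec_nth)
  qed
  then show ?thesis
    by (intro continuous_on_polymonial_function) (simp add: real_polynomial_function_eq)
qed

text \<open>On the segment from the identity to \<open>A\<close> all matrices are positive definite, hence nonsingular, so the
  determinant cannot change sign.\<close>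

lemma pos_def_det_pos:
  assumes "pos_def (A :: real^'n^'n)" shows "det A > 0"
proof (rule ccontr)
  assume "\<not> det A > 0"
  let ?h = "\<lambda>t :: real. (1 - t) *\<^sub>R mat 1 + t *\<^sub>R A"
  have "continuous_on {0..1} (\<lambda>t. det (?h t))"
    by (rule continuous_on_compose2[OF continuous_on_det[of UNIV]]) (auto intro!: continuous_intros)
  moreover have "det (?h 1) \<le> 0" "0 \<le> det (?h 0)" using \<open>\<not> det A > 0\<close> by simp_all
  ultimately obtain t where t: "0 \<le> t" "t \<le> 1" "det (?h t) = 0"
    using IVT2'[of "\<lambda>t. det (?h t)" 1 0 0] by auto
  have "pos_def (?h t)"
    unfolding pos_def_def
  proof (intro conjI allI impI)
    show "?h t \<in> sym_mats"
      using assms by (auto simp: pos_def_def sym_mats_def transpose_def mat_def vec_eq_iff)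
    fix x :: "real^'n" assume x: "x \<noteq> 0"
    have "?h t *v x = (1 - t) *\<^sub>R x + t *\<^sub>R (A *v x)"
      by (simp add: matrix_vector_mult_add_rdistrib flip: scaleR_matrix_vector_assoc)
    then have "x \<bullet> (?h t *v x) = (1 - t) * (x \<bullet> x) + t * (x \<bullet> (A *v x))"
      by (simp add: inner_add_right)
    moreover have "x \<bullet> x > 0" "x \<bullet> (A *v x) > 0" using x assms by (auto simp: pos_def_def)
    ultimately show "x \<bullet> (?h t *v x) > 0"
      using t by (cases "t = 0") (auto intro: add_nonneg_pos)
  qed
  then show False using t(3) by (simp add: pos_def_iff)
qed

lemma abs_det_le: "\<bar>det A\<bar> \<le> fact CARD('n) * norm A ^ CARD('n)" for A :: "real^'n^'n"
proof -
  have entry: "\<bar>A $ i $ j\<bar> \<le> norm A" for i j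
    by (rule order_trans[OF component_le_norm_cart Finite_Cartesian_Product.norm_nth_le])
  have "\<bar>det A\<bar> \<le> (\<Sum>p\<in>{p. p permutes (UNIV :: 'n set)}. \<bar>of_int (sign p) * (\<Prod>i\<in>UNIV. A $ i $ p i)\<bar>)"
    unfolding det_def by (rule sum_abs)
  also have "\<dots> \<le> (\<Sum>p\<in>{p. p permutes (UNIV :: 'n set)}. norm A ^ CARD('n))"
  proof (rule sum_mono)
    fix p :: "'n \<Rightarrow> 'n"
    have "\<bar>of_int (sign p) * (\<Prod>i\<in>UNIV. A $ i $ p i)\<bar> = (\<Prod>i\<in>UNIV. \<bar>A $ i $ p i\<bar>)"
      by (simp add: abs_mult abs_prod sign_def)
    also have "\<dots> \<le> (\<Prod>i\<in>(UNIV :: 'n set). norm A)" using entry by (intro prod_mono) auto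
    finally show "\<bar>of_int (sign p) * (\<Prod>i\<in>UNIV. A $ i $ p i)\<bar> \<le> norm A ^ CARD('n)" by simp
  qed
  also have "\<dots> = fact CARD('n) * norm A ^ CARD('n)"
    by (simp add: card_permutations[OF refl])
  finally show ?thesis .
qed

lemma closed_psd: "closed {A :: real^'n^'n. psd A}"
proof -
  have 1: "closed {A :: real^'n^'n. transpose A = A}"
    by (intro closed_Collect_eq linear_continuous_on bounded_linear_transpose continuous_on_id)
  have "closed {A :: real^'n^'n. 0 \<le> x \<bullet> (A *v x)}" for x
  proof -
    have "linear (\<lambda>A :: real^'n^'n. x \<bullet> (A *v x))"
      by (rule linearI) (simp_all add: matrix_vector_mult_add_rdistrib inner_add_right flip: scaleR_matrix_vector_assoc)
    then show ?thesis
      by (intro closed_Collect_le continuous_on_const linear_continuous_on)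
        (simp add: linear_conv_bounded_linear)
  qed
  then have "closed (\<Inter>x. {A :: real^'n^'n. 0 \<le> x \<bullet> (A *v x)})" by blast
  moreover have "{A :: real^'n^'n. psd A} = {A. transpose A = A} \<inter> (\<Inter>x. {A. 0 \<le> x \<bullet> (A *v x)})"
    by (auto simp: psd_def sym_mats_def)
  ultimately show ?thesis using 1 by auto
qed

lemma bounded_linear_trace_mult: "bounded_linear (\<lambda>K :: real^'n^'n. trace (S ** K))"
proof -
  have "linear (\<lambda>K :: real^'n^'n. trace (S ** K))"
    by (rule linearI) (simp_all add: trace_def matrix_matrix_mult_def sum.distrib distrib_left sum_distrib_left mult_ac)
  then show ?thesis by (simp add: linear_conv_bounded_linear)
qed

text \<open>The constant is the minimum of \<open>Tr (S K)\<close> over the compact set of unit-norm positive semidefinite \<open>K\<close> in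
  \<open>L\<close>, or arbitrary if this set is empty. The minimum is positive because \<open>Tr (S K) = 0\<close> forces \<open>K S = 0\<close>.\<close>

lemma trace_mult_coercive:
  fixes L :: "(real^'n^'n) set"
  assumes L: "subspace L" and S: "psd S" and no: "\<not> (\<exists>\<Omega>\<in>L. \<Omega> \<noteq> 0 \<and> \<Omega> ** S = 0)"
  obtains c where "c > 0" "\<And>K. K \<in> L \<Longrightarrow> psd K \<Longrightarrow> c * norm K \<le> trace (S ** K)"
proof (cases "\<exists>K. K \<in> L \<and> psd K \<and> norm K = 1")
  case True
  define X where "X = (L \<inter> {K. psd K}) \<inter> sphere 0 1"
  have "compact X" unfolding X_def
    using closed_subspace[OF L] closed_psd by (intro closed_Int_compact closed_Int) auto
  moreover have "X \<noteq> {}" using True by (auto simp: X_def)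
  moreover have "continuous_on X (\<lambda>K. trace (S ** K))"
    by (intro linear_continuous_on bounded_linear_trace_mult)
  ultimately obtain K0 where K0: "K0 \<in> X" "\<And>K. K \<in> X \<Longrightarrow> trace (S ** K0) \<le> trace (S ** K)"
    using continuous_attains_inf[of X "\<lambda>K. trace (S ** K)"] by blast
  show thesis
  proof (rule that[of "trace (S ** K0)"])
    have "psd K0" "K0 \<in> L" "K0 \<noteq> 0" using K0(1) by (auto simp: X_def)
    then have "trace (S ** K0) \<noteq> 0" using no trace_mult_psd(2)[OF S] by blast
    then show "trace (S ** K0) > 0" using trace_mult_psd(1)[OF S \<open>psd K0\<close>] by simp
    fix K assume K: "K \<in> L" "psd K"
    show "trace (S ** K0) * norm K \<le> trace (S ** K)"
    proof (cases "K = 0")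
      case True
      then show ?thesis using trace_mult_psd(1)[OF S K(2)] by simp
    next
      case False
      have "psd ((1 / norm K) *\<^sub>R K)"
        using K(2) by (auto simp: psd_def sym_mats_def transpose_def vec_eq_iff simp flip: scaleR_matrix_vector_assoc)
      then have "(1 / norm K) *\<^sub>R K \<in> X" using False K(1) L by (simp add: X_def subspace_scale)
      then have "trace (S ** K0) \<le> trace (S ** ((1 / norm K) *\<^sub>R K))" by (rule K0(2))
      also have "\<dots> = trace (S ** K) / norm K"
        using linear_simps(5)[OF bounded_linear_trace_mult, of S "1 / norm K" K] by simp
      finally show ?thesis using False by (simp add: field_simps)
    qed
  qed
next
  case False
  have "K = 0" if "K \<in> L" "psd K" for K
  proof (rule ccontr)
    assume "K \<noteq> 0"
    have "psd ((1 / norm K) *\<^sub>R K)"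
      using that(2) by (auto simp: psd_def sym_mats_def transpose_def vec_eq_iff simp flip: scaleR_matrix_vector_assoc)
    moreover have "(1 / norm K) *\<^sub>R K \<in> L" using that(1) L by (simp add: subspace_scale)
    moreover have "norm ((1 / norm K) *\<^sub>R K) = 1" using \<open>K \<noteq> 0\<close> by simp
    ultimately show False using False by blast
  qed
  then have "1 * norm K \<le> trace (S ** K)" if "K \<in> L" "psd K" for K
    using that trace_mult_psd(1)[OF S that(2)] by fastforce
  then show thesis using that[of 1] by simp
qed

text \<open>The sublevel set of a positive definite \<open>K0\<close> lies in a compact set \<open>X\<close> on which the determinant is
  bounded away from zero. Norms are bounded because \<open>Tr (S K) \<ge> c \<parallel>K\<parallel>\<close> outgrows
  \<open>log det K \<le> n log \<parallel>K\<parallel> + const\<close>, and the determinant is bounded below because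
  \<open>Tr (S K) \<ge> 0\<close>. A minimum over \<open>X\<close> is then a global one.\<close>

lemma MLE_exists_of_no_annihilator:
  fixes L :: "(real^'n^'n) set"
  assumes L: "subspace L" and S: "psd S" and no: "\<not> (\<exists>\<Omega>\<in>L. \<Omega> \<noteq> 0 \<and> \<Omega> ** S = 0)"
    and K0: "K0 \<in> L" "pos_def K0"
  shows "MLE_exists L S"
proof -
  obtain c where c: "c > 0" "\<And>K. K \<in> L \<Longrightarrow> psd K \<Longrightarrow> c * norm K \<le> trace (S ** K)"
    using trace_mult_coercive[OF L S no] by metis
  let ?f = "neg_log_lik S"
  define M where "M = ?f K0"
  define n where "n = real CARD('n)"
  have n: "n > 0" by (simp add: n_def)
  define R where "R = 2 / c * (M + ln (fact CARD('n)) + n * ln (2 * n / c))"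
  define X where "X = ((L \<inter> {K. psd K}) \<inter> {K. exp (- M) \<le> det K}) \<inter> cball 0 R"
  have sublevel: "K \<in> X" if K: "K \<in> L" "pos_def K" "?f K \<le> M" for K
  proof -
    have psd: "psd K" and det: "det K > 0" using K(2) pos_def_iff pos_def_det_pos by auto
    have "K \<noteq> 0" using det abs_det_le[of "0 :: real^'n^'n"] by (auto simp: power_0_left)
    then have r: "norm K > 0" by simp
    have "- M \<le> ln (det K)"
      using trace_mult_psd(1)[OF S psd] K(3) by (simp add: neg_log_lik_def)
    then have "exp (- M) \<le> det K" using det by (metis exp_le_cancel_iff exp_ln)
    moreover have "norm K \<le> R"
    proof -
      have "ln (det K) \<le> ln (fact CARD('n) * norm K ^ CARD('n))"
        using det abs_det_le[of K] r by (subst ln_le_cancel_iff) auto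
      also have "\<dots> = ln (fact CARD('n)) + n * ln (norm K)"
        using r by (simp add: ln_mult ln_realpow n_def)
      finally have "c * norm K \<le> M + ln (fact CARD('n)) + n * ln (norm K)"
        using c(2)[OF K(1) psd] K(3) by (simp add: neg_log_lik_def)
      moreover have "n * ln (norm K) \<le> c * norm K / 2 + n * ln (2 * n / c)"
      proof -
        \<comment> \<open>Scaling by \<open>c / (2 n)\<close> makes the tangent-line bound \<open>ln t \<le> t - 1\<close> absorb half of the linear term.\<close>
        have "ln (norm K) = ln (c * norm K / (2 * n)) + ln (2 * n / c)"
        proof -
          have "norm K = c * norm K / (2 * n) * (2 * n / c)" using c(1) n by simp
          then have "ln (norm K) = ln (c * norm K / (2 * n) * (2 * n / c))" by simp
          also have "\<dots> = ln (c * norm K / (2 * n)) + ln (2 * n / c)"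
            using c(1) n r by (intro ln_mult_pos) auto
          finally show ?thesis .
        qed
        moreover have "ln (c * norm K / (2 * n)) \<le> c * norm K / (2 * n) - 1"
          using c(1) n r by (intro ln_le_minus_one) simp
        ultimately have "ln (norm K) \<le> c * norm K / (2 * n) + ln (2 * n / c)" by simp
        then have "n * ln (norm K) \<le> n * (c * norm K / (2 * n) + ln (2 * n / c))"
          using n by (intro mult_left_mono) auto
        then show ?thesis using n by (simp add: distrib_left)
      qed
      ultimately have "c * norm K / 2 \<le> M + ln (fact CARD('n)) + n * ln (2 * n / c)" by simp
      then show ?thesis unfolding R_def using c(1) by (simp add: field_simps)
    qed
    ultimately show ?thesis using K(1) psd by (simp add: X_def)
  qed
  have "compact X" unfolding X_def
    using closed_subspace[OF L] closed_psd
    by (intro closed_Int_compact closed_Int closed_Collect_le continuous_on_const continuous_on_det) auto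
  moreover have "K0 \<in> X" using sublevel K0 by (simp add: M_def)
  moreover have det_X: "det K > 0" if "K \<in> X" for K
    using that unfolding X_def by (auto intro: less_le_trans[OF exp_gt_zero])
  then have "continuous_on X ?f"
    unfolding neg_log_lik_def
    by (intro continuous_on_diff continuous_on_ln linear_continuous_on bounded_linear_trace_mult continuous_on_det)
      force+
  ultimately obtain K where K: "K \<in> X" "\<And>K'. K' \<in> X \<Longrightarrow> ?f K \<le> ?f K'"
    using continuous_attains_inf[of X ?f] by blast
  have "pos_def K" using K(1) det_X[OF K(1)] by (simp add: pos_def_iff X_def)
  moreover have "?f K \<le> ?f K'" if "K' \<in> L" "pos_def K'" for K'
  proof (cases "?f K' \<le> M")
    case True
    then show ?thesis using sublevel that K(2) by blast
  next
    case False
    then show ?thesis using K(2)[OF \<open>K0 \<in> X\<close>] by (simp add: M_def)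
  qed
  moreover have "K \<in> L" using K(1) by (simp add: X_def)
  ultimately show ?thesis unfolding MLE_exists_def by blast
qed

section \<open>Generic completion rank and maximum likelihood threshold\<close>

theorem theorem4p5:
  fixes L :: "(real^'n^'n) set"
  assumes "subspace L" and "L \<subseteq> sym_mats"
  shows "(generic_psd (GCR L) (\<lambda>S. \<not> (\<exists>\<Omega>\<in>L. \<Omega> \<noteq> 0 \<and> \<Omega> ** S = 0)) \<and>
          (\<forall>d. generic_psd d (\<lambda>S. \<not> (\<exists>\<Omega>\<in>L. \<Omega> \<noteq> 0 \<and> \<Omega> ** S = 0)) \<longrightarrow> GCR L \<le> d)) \<and>
         ((\<exists>K\<in>L. pos_def K) \<longrightarrow> GCR L \<ge> MLT L)"
proof -
  let ?Q = "\<lambda>d. generic_psd d (\<lambda>S. \<not> (\<exists>\<Omega>\<in>L. \<Omega> \<noteq> 0 \<and> \<Omega> ** S = 0))"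
  have GCR: "GCR L = (LEAST d. ?Q d)"
    unfolding GCR_def projection_full_dimensional_iff_generic[OF assms] ..
  have "no_annihilator L UNIV"
    unfolding no_annihilator_def by (metis UNIV_I matrix_eq matrix_vector_mult_0)
  then have "?Q (dim (UNIV :: (real^'n) set))"
    unfolding generic_psd_iff_subspace[OF assms] using subspace_UNIV by blast
  then have 1: "?Q (GCR L)" unfolding GCR by (rule LeastI)
  have 2: "GCR L \<le> d" if "?Q d" for d
    using that unfolding GCR by (rule Least_le)
  have 3: "MLT L \<le> GCR L" if K: "K \<in> L" "pos_def K" for K
  proof -
    obtain U where U: "zariski_open_in (psd_rank (GCR L)) U" "U \<noteq> {}"
      "\<And>S. S \<in> U \<Longrightarrow> \<not> (\<exists>\<Omega>\<in>L. \<Omega> \<noteq> 0 \<and> \<Omega> ** S = 0)"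
      using 1 unfolding generic_psd_def by metis
    have "MLE_exists L S" if S: "S \<in> U" for S
    proof -
      have "psd S" using S U(1) unfolding zariski_open_in_def psd_rank_def by blast
      then show ?thesis by (rule MLE_exists_of_no_annihilator[OF assms(1) _ U(3)[OF S] K])
    qed
    then have "generic_psd (GCR L) (MLE_exists L)" unfolding generic_psd_def using U(1,2) by blast
    then show ?thesis unfolding MLT_def by (rule Least_le)
  qed
  show ?thesis using 1 2 3 by blast
qed

end
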